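(* Let \(G\) be a strongly connected directed Eulerian multigraph with \(m\) arcs, and let \(G^\star\) be constructed as described in the context, with gadget errors \(\eta_v\) and construction-failure parameters \(\delta_v\) for \(v\in V_{\ge2}\), each gadget satisfying the pointwise bound with error \(\eta_v\). Let \(\eta_{\mathrm{tot}}=\sum_{v\in V_{\ge2}}\eta_v\). If \(\mathrm{ET}(G^\star)\ne\varnothing\), \(T^\star\) is uniform on \(\mathrm{ET}(G^\star)\), and \(T\) is its projection to \(G\), then \[ \frac{e^{-2\eta_{\mathrm{tot}}}}{|\mathrm{ET}(G)|}\le\Pr[T=T_0]\le\frac{e^{2\eta_{\mathrm{tot}}}}{|\mathrm{ET}(G)|}\quad\text{for all }T_0\in\mathrm{ET}(G), \] and consequently \(\|\mathcal L(T)-\mathrm{Unif}(\mathrm{ET}(G))\|_{\mathrm{TV}}\le e^{2\eta_{\mathrm{tot}}}-1\). If \(V_{\ge2}\ne\varnothing\), then \(G^\star\) has \(M=O\!\left(m\,\mathrm{polylog}(m/(\eta_{\min}\delta_{\min}))\right)\) arcs, where \(\eta_{\min}=\min_{v\in V_{\ge2}}\eta_v\), \(\delta_{\min}=\min_{v\in V_{\ge2}}\delta_v\). If \(V_{\ge2}=\varnothing\), all local transitions are forced and no gadget is needed.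
   Context: Transition systems, induced arc permutations and \(\mathrm{ET}(\cdot)\) (one-cycle transition systems) are as usual: each vertex gets a bijection from incoming to outgoing incidences. Suppressing a degree-one vertex \(v\) (unique in-arc \(e\ne\) unique out-arc \(f\)) replaces \(e,f\) by one arc from the tail of \(e\) to the head of \(f\). A \(D\)-wire switching network: \(D\) input ports, \(D\) output ports, switches with two incoming and two outgoing wire segments, each switch set straight or crossed; a full setting induces a permutation in \(S_D\). The random network used here (with parameters \(D,\eta,\delta\)) places switches on wire pairs \((1,2),(2,3),\dots,(D-1,D)\) in order, followed by \(R=2\lceil CD(\log D+\log(1/(\eta\delta)))\rceil\) switches on independent uniformly random unordered pairs of wires, \(C\) a suitable absolute constant; it has \(O(D\,\mathrm{polylog}(D/(\eta\delta)))\) switches and arcs. Construction of \(G^\star\): if every vertex of \(G\) has degree one, no gadgets are added. Otherwise repeatedly suppress degree-one vertices until none remain; let \(V_{\ge2}\) be the remaining vertices, each of degree \(d_v\ge2\). Replace each \(v\in V_{\ge2}\) by such a random \(d_v\)-wire network built with parameters \((d_v,\eta_v,\delta_v)\): attach incoming arcs of \(v\) to input ports and outgoing arcs to output ports, then suppress ports (replace maximal directed paths through ports by single arcs). The gadget satisfies the pointwise bound with error \(\eta_v\) if uniform independent switch settings induce a distribution \(\mu_v\) on \(S_{d_v}\) with \(e^{-\eta_v}/d_v!\le\mu_v(\sigma)\le e^{\eta_v}/d_v!\) for all \(\sigma\). Projection: from a transition system of \(G^\star\), read the permutation each gadget realizes as the local transition at \(v\), then undo the degree-one suppressions to get a transition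 system of \(G\). *)

theory Defs
  imports "Graph_Theory.Graph_Theory" "HOL-Combinatorics.Combinatorics" "HOL-Probability.Probability"
begin

section \<open>Eulerian digraphs and one-cycle transition systems\<close>

definition eulerian_digraph :: "('v, 'e) pre_digraph \<Rightarrow> bool" where
  "eulerian_digraph G \<longleftrightarrow> fin_digraph G \<and> (\<forall>v \<in> verts G. in_degree G v = out_degree G v)"

definition local_transitions :: "('v, 'e) pre_digraph \<Rightarrow> 'v \<Rightarrow> ('e \<Rightarrow> 'e) set" where
  "local_transitions G v =
    {\<tau> \<in> in_arcs G v \<rightarrow>\<^sub>E out_arcs G v. bij_betw \<tau> (in_arcs G v) (out_arcs G v)}"

text \<open>Transition systems are extensional in both arguments, so that sets of them are finite
  and are counted correctly.\<close>

definition transition_systems :: "('v, 'e) pre_digraph \<Rightarrow> ('v \<Rightarrow> 'e \<Rightarrow> 'e) set" where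
  "transition_systems G = (\<Pi>\<^sub>E v \<in> verts G. local_transitions G v)"

definition arc_perm :: "('v, 'e) pre_digraph \<Rightarrow> ('v \<Rightarrow> 'e \<Rightarrow> 'e) \<Rightarrow> 'e \<Rightarrow> 'e" where
  "arc_perm G T e = (if e \<in> arcs G then T (head G e) e else e)"

definition ET :: "('v, 'e) pre_digraph \<Rightarrow> ('v \<Rightarrow> 'e \<Rightarrow> 'e) set" where
  "ET G = {T \<in> transition_systems G. cyclic_on (arc_perm G T) (arcs G)}"


section \<open>Suppressing degree-one vertices\<close>

definition degree_one :: "('v, 'e) pre_digraph \<Rightarrow> 'v \<Rightarrow> bool" where
  "degree_one G v \<longleftrightarrow> in_degree G v = 1 \<and> out_degree G v = 1"

definition suppressible :: "('v, 'e) pre_digraph \<Rightarrow> 'v \<Rightarrow> bool" where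
  "suppressible G v \<longleftrightarrow> v \<in> verts G \<and> degree_one G v \<and> in_arcs G v \<noteq> out_arcs G v"

abbreviation the_in_arc :: "('v, 'e) pre_digraph \<Rightarrow> 'v \<Rightarrow> 'e" where
  "the_in_arc G v \<equiv> the_elem (in_arcs G v)"

abbreviation the_out_arc :: "('v, 'e) pre_digraph \<Rightarrow> 'v \<Rightarrow> 'e" where
  "the_out_arc G v \<equiv> the_elem (out_arcs G v)"

text \<open>The arc replacing the in-arc e and the out-arc f of v keeps the name e.\<close>

definition suppress :: "('v, 'e) pre_digraph \<Rightarrow> 'v \<Rightarrow> ('v, 'e) pre_digraph" where
  "suppress G v =
    \<lparr> verts = verts G - {v},
      arcs = arcs G - {the_out_arc G v},
      tail = tail G,
      head = (head G)(the_in_arc G v := head G (the_out_arc G v)) \<rparr>"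

fun suppress_all :: "('v, 'e) pre_digraph \<Rightarrow> 'v list \<Rightarrow> ('v, 'e) pre_digraph" where
  "suppress_all G [] = G"
| "suppress_all G (v # vs) = suppress_all (suppress G v) vs"

fun suppression_sequence :: "('v, 'e) pre_digraph \<Rightarrow> 'v list \<Rightarrow> bool" where
  "suppression_sequence G [] \<longleftrightarrow> True"
| "suppression_sequence G (v # vs) \<longleftrightarrow> suppressible G v \<and> suppression_sequence (suppress G v) vs"

text \<open>Undoing a suppression: the transition at v is forced, and elsewhere the merged arc e
  enters its head through the out-arc f of v.\<close>

definition unsuppress ::
    "('v, 'e) pre_digraph \<Rightarrow> 'v \<Rightarrow> ('v \<Rightarrow> 'e \<Rightarrow> 'e) \<Rightarrow> 'v \<Rightarrow> 'e \<Rightarrow> 'e" where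
  "unsuppress G v T =
    (\<lambda>w \<in> verts G. \<lambda>a \<in> in_arcs G w.
       if w = v then the_out_arc G v
       else if a = the_out_arc G v then T w (the_in_arc G v)
       else T w a)"

fun unsuppress_all ::
    "('v, 'e) pre_digraph \<Rightarrow> 'v list \<Rightarrow> ('v \<Rightarrow> 'e \<Rightarrow> 'e) \<Rightarrow> 'v \<Rightarrow> 'e \<Rightarrow> 'e" where
  "unsuppress_all G [] T = T"
| "unsuppress_all G (v # vs) T = unsuppress G v (unsuppress_all (suppress G v) vs T)"


section \<open>Switching networks\<close>

text \<open>A network on the wires 0, ..., D - 1 is given by the list of its switches, each switch being
  the unordered pair of wires it acts on. A setting is a list of Booleans of the same length,
  where True means crossed. The realized permutation maps the input port at which a signal
  enters to the output port at which it leaves.\<close>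

fun net_perm :: "nat set list \<Rightarrow> bool list \<Rightarrow> nat \<Rightarrow> nat" where
  "net_perm (p # ps) (b # bs) =
    net_perm ps bs \<circ> (if b then Transposition.transpose (Min p) (Max p) else id)"
| "net_perm _ _ = id"

definition switching_distribution :: "nat set list \<Rightarrow> (nat \<Rightarrow> nat) pmf" where
  "switching_distribution ps = map_pmf (net_perm ps) (pmf_of_set {bs. length bs = length ps})"

definition pointwise_bound :: "nat \<Rightarrow> nat set list \<Rightarrow> real \<Rightarrow> bool" where
  "pointwise_bound D ps \<eta> \<longleftrightarrow>
    (\<forall>\<sigma>. \<sigma> permutes {..<D} \<longrightarrow>
       exp (- \<eta>) / fact D \<le> pmf (switching_distribution ps) \<sigma> \<and>
       pmf (switching_distribution ps) \<sigma> \<le> exp \<eta> / fact D)"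

definition adjacent_switches :: "nat \<Rightarrow> nat set list" where
  "adjacent_switches D = map (\<lambda>i. {i, Suc i}) [0..<D - 1]"

definition num_random_switches :: "real \<Rightarrow> nat \<Rightarrow> real \<Rightarrow> real \<Rightarrow> nat" where
  "num_random_switches C D \<eta> \<delta> = 2 * nat \<lceil>C * real D * (ln (real D) + ln (1 / (\<eta> * \<delta>)))\<rceil>"

definition random_network :: "real \<Rightarrow> nat \<Rightarrow> real \<Rightarrow> real \<Rightarrow> nat set list pmf" where
  "random_network C D \<eta> \<delta> =
    map_pmf (\<lambda>ps. adjacent_switches D @ ps)
      (replicate_pmf (num_random_switches C D \<eta> \<delta>)
        (pmf_of_set {p. p \<subseteq> {..<D} \<and> card p = 2}))"


section \<open>The gadget graph\<close>

text \<open>Vertices outside the set of replaced vertices survive as \<open>Orig\<close>; such vertices occur only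
  if no gadget is added at all. \<open>Switch v k\<close> is the k-th switch in the gadget of v.\<close>

datatype 'v net_vert = Orig 'v | InPort 'v nat | OutPort 'v nat | Switch 'v nat

text \<open>\<open>Ext e\<close> is an arc of the graph whose vertices are being replaced. \<open>Seg v i 0\<close> is the segment
  of wire i leaving the i-th input port of the gadget of v, and \<open>Seg v i (Suc k)\<close> is the segment
  of wire i leaving its k-th switch.\<close>

datatype ('v, 'e) net_arc = Ext (ext_arc: 'e) | Seg 'v (wire: nat) nat

record ('v, 'e) construction =
  removal_order :: "'v list"
  in_port :: "'e \<Rightarrow> nat"
  out_port :: "'e \<Rightarrow> nat"
  network :: "'v \<Rightarrow> nat set list"
  port_order :: "'v net_vert list"
  gadget_error :: "'v \<Rightarrow> real"
  failure_param :: "'v \<Rightarrow> real"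

definition reduced :: "('v, 'e) pre_digraph \<Rightarrow> ('v, 'e) construction \<Rightarrow> ('v, 'e) pre_digraph" where
  "reduced G c = suppress_all G (removal_order c)"

definition V_ge2 :: "('v, 'e) pre_digraph \<Rightarrow> ('v, 'e) construction \<Rightarrow> 'v set" where
  "V_ge2 G c = {v \<in> verts (reduced G c). 2 \<le> in_degree (reduced G c) v}"

abbreviation deg :: "('v, 'e) pre_digraph \<Rightarrow> ('v, 'e) construction \<Rightarrow> 'v \<Rightarrow> nat" where
  "deg G c v \<equiv> in_degree (reduced G c) v"

text \<open>End of the segment of wire i of the gadget of v that starts just before switch t: the first
  switch from number t on that involves wire i, or the output port if there is none.\<close>

definition next_vert :: "nat set list \<Rightarrow> 'v \<Rightarrow> nat \<Rightarrow> nat \<Rightarrow> 'v net_vert" where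
  "next_vert ps v i t =
    (if \<exists>k. t \<le> k \<and> k < length ps \<and> i \<in> ps ! k
     then Switch v (LEAST k. t \<le> k \<and> k < length ps \<and> i \<in> ps ! k)
     else OutPort v i)"

definition ports :: "('v, 'e) pre_digraph \<Rightarrow> ('v, 'e) construction \<Rightarrow> 'v net_vert set" where
  "ports G c = (\<Union>v \<in> V_ge2 G c. InPort v ` {..<deg G c v} \<union> OutPort v ` {..<deg G c v})"

text \<open>The graph with all gadgets inserted, before the ports are suppressed.\<close>

definition port_graph ::
    "('v, 'e) pre_digraph \<Rightarrow> ('v, 'e) construction \<Rightarrow> ('v net_vert, ('v, 'e) net_arc) pre_digraph" where
  "port_graph G c =
    (let H = reduced G c; W = V_ge2 G c in
    \<lparr> verts = Orig ` (verts H - W) \<union> ports G c \<union>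
        (\<Union>v \<in> W. Switch v ` {..<length (network c v)}),
      arcs = Ext ` arcs H \<union>
        {Seg v i 0 | v i. v \<in> W \<and> i < deg G c v} \<union>
        {Seg v i (Suc k) | v i k. v \<in> W \<and> k < length (network c v) \<and> i \<in> network c v ! k},
      tail = (\<lambda>a. case a of
          Ext e \<Rightarrow> if tail H e \<in> W then OutPort (tail H e) (out_port c e) else Orig (tail H e)
        | Seg v i t \<Rightarrow> (case t of 0 \<Rightarrow> InPort v i | Suc k \<Rightarrow> Switch v k)),
      head = (\<lambda>a. case a of
          Ext e \<Rightarrow> if head H e \<in> W then InPort (head H e) (in_port c e) else Orig (head H e)
        | Seg v i t \<Rightarrow> next_vert (network c v) v i t) \<rparr>)"

definition Gstar ::
    "('v, 'e) pre_digraph \<Rightarrow> ('v, 'e) construction \<Rightarrow> ('v net_vert, ('v, 'e) net_arc) pre_digraph" where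
  "Gstar G c = suppress_all (port_graph G c) (port_order c)"

text \<open>The data c describe a possible outcome of the construction, for the constant C in the length
  of the random networks. All choices left open (the order of suppressions, the assignment of
  arcs to ports, the random switches) are arbitrary.\<close>

definition valid_construction ::
    "real \<Rightarrow> ('v, 'e) pre_digraph \<Rightarrow> ('v, 'e) construction \<Rightarrow> bool" where
  "valid_construction C G c \<longleftrightarrow>
    (if \<forall>v \<in> verts G. degree_one G v then removal_order c = []
     else suppression_sequence G (removal_order c) \<and>
          (\<forall>v \<in> verts (reduced G c). \<not> degree_one (reduced G c) v)) \<and>
    (\<forall>v \<in> V_ge2 G c.
       0 < gadget_error c v \<and> 0 < failure_param c v \<and>
       network c v \<in> set_pmf (random_network C (deg G c v) (gadget_error c v) (failure_param c v)) \<and>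
       bij_betw (in_port c) (in_arcs (reduced G c) v) {..<deg G c v} \<and>
       bij_betw (out_port c) (out_arcs (reduced G c) v) {..<deg G c v}) \<and>
    suppression_sequence (port_graph G c) (port_order c) \<and>
    set (port_order c) = ports G c"


section \<open>Projection\<close>

text \<open>Switch k of the gadget of v is crossed by a transition system of the port graph iff
  an incoming segment is continued on a different wire.\<close>

definition gadget_setting ::
    "('v, 'e) pre_digraph \<Rightarrow> ('v, 'e) construction \<Rightarrow>
      ('v net_vert \<Rightarrow> ('v, 'e) net_arc \<Rightarrow> ('v, 'e) net_arc) \<Rightarrow> 'v \<Rightarrow> bool list" where
  "gadget_setting G c T v =
    map (\<lambda>k. \<exists>a \<in> in_arcs (port_graph G c) (Switch v k). wire (T (Switch v k) a) \<noteq> wire a)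
      [0..<length (network c v)]"

definition read_gadgets ::
    "('v, 'e) pre_digraph \<Rightarrow> ('v, 'e) construction \<Rightarrow>
      ('v net_vert \<Rightarrow> ('v, 'e) net_arc \<Rightarrow> ('v, 'e) net_arc) \<Rightarrow> 'v \<Rightarrow> 'e \<Rightarrow> 'e" where
  "read_gadgets G c T =
    (\<lambda>v \<in> verts (reduced G c). \<lambda>e \<in> in_arcs (reduced G c) v.
       if v \<in> V_ge2 G c
       then inv_into (out_arcs (reduced G c) v) (out_port c)
              (net_perm (network c v) (gadget_setting G c T v) (in_port c e))
       else ext_arc (T (Orig v) (Ext e)))"

definition projection ::
    "('v, 'e) pre_digraph \<Rightarrow> ('v, 'e) construction \<Rightarrow>
      ('v net_vert \<Rightarrow> ('v, 'e) net_arc \<Rightarrow> ('v, 'e) net_arc) \<Rightarrow> 'v \<Rightarrow> 'e \<Rightarrow> 'e" where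
  "projection G c T =
    unsuppress_all G (removal_order c)
      (read_gadgets G c (unsuppress_all (port_graph G c) (port_order c) T))"


section \<open>Total variation distance\<close>

definition tv_dist :: "'a pmf \<Rightarrow> 'a pmf \<Rightarrow> real" where
  "tv_dist p q = (SUP A. \<bar>measure_pmf.prob p A - measure_pmf.prob q A\<bar>)"

end

theory Submission
  imports Defs
begin

text \<open>Suppressing a degree-one vertex deletes one arc from the cycle of the arc permutation, so undoing
  suppressions is a bijection between one-cycle transition systems. A transition system of the graph
  with gadgets is the same thing as a setting of all switches. Gadgets are acyclic, so its arc
  permutation returns to the outer arcs exactly as the transition system read off prescribes, and one
  is a single cycle iff the other is. Hence each one-cycle transition system of the reduced graph is
  hit by a number of switch settings that is a product over the gadgets, and the pointwise bounds
  make this number constant up to factors exp of plus or minus the total error; normalizing costs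
  the same factor again.\<close>

text \<open>The obstacle is that being a single cycle is a global and possibly rare condition. Under
  the uniform law on the one-cycle transition systems the gadget settings are not independent,
  whereas the gadget bounds speak of independent uniform settings. Counting avoids conditioning: if
  \<open>S\<close> is a single cycle, every setting that reads as \<open>S\<close> is automatically
  one, so the fibre over \<open>S\<close> is cut out by one separate condition per gadget. Its size
  is the product of the numbers of settings of each gadget times the probability of the permutation
  that \<open>S\<close> prescribes there. Pointwise multiplicative bounds survive this product and
  the later division; an additive error per gadget could be swamped by the rarity of the event. Both
  reductions rest on the same principle: a map is a single cycle iff its first-return map to a set
  met by every orbit is one. For a suppression the complement of that set is one arc, for the
  gadgets it consists of all segments.\<close>

section \<open>First returns of cyclic maps\<close>

text \<open>A relation rather than an iterate at a least time: the number of segments that a signal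
  crosses depends on the setting, and this way it is never computed. Time zero counts, so a first
  return from \<open>b\<close> is a first hit started one step after \<open>b\<close>.\<close>

inductive first_hit :: "('a \<Rightarrow> 'a) \<Rightarrow> 'a set \<Rightarrow> 'a \<Rightarrow> 'a \<Rightarrow> bool" for f B where
  here: "b \<in> B \<Longrightarrow> first_hit f B b b"
| step: "a \<notin> B \<Longrightarrow> first_hit f B (f a) b \<Longrightarrow> first_hit f B a b"

lemma first_hit_in: "first_hit f B a b \<Longrightarrow> b \<in> B"
  by (induction rule: first_hit.induct) auto

lemma first_hit_funpow:
  assumes "first_hit f B a b"
  obtains n where "b = (f ^^ n) a"
  using assms
proof (induction arbitrary: thesis rule: first_hit.induct)
  case (here b)
  then show ?case by (metis funpow_0)
next
  case (step a b)
  obtain n where "b = (f ^^ n) (f a)" using step.IH by blast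
  then show ?case using step.prems[of "Suc n"] by (simp add: funpow_swap1)
qed

text \<open>No visit to \<open>B\<close> precedes the first hit, so a later visit passes through it.
  The bound on \<open>k\<close> is the measure for the induction in
  \<open>cyclic_on_first_return\<close>.\<close>

lemma first_hit_le:
  assumes "first_hit f B a b" "(f ^^ n) a \<in> B"
  obtains k where "k \<le> n" "(f ^^ n) a = (f ^^ k) b"
  using assms
proof (induction arbitrary: n thesis rule: first_hit.induct)
  case (here b)
  then show ?case by blast
next
  case (step a b)
  obtain m where m: "n = Suc m"
    using step.hyps(1) step.prems(2) by (cases n) auto
  then have "(f ^^ m) (f a) \<in> B" using step.prems(2) by (simp add: funpow_swap1)
  then obtain k where "k \<le> m" "(f ^^ m) (f a) = (f ^^ k) b"
    using step.IH by blast
  then show ?case using step.prems(1)[of k] m by (simp add: funpow_swap1)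
qed

lemma cyclic_on_first_return:
  assumes sub: "h ` B \<subseteq> A" and closed: "\<And>a. a \<in> A \<Longrightarrow> f a \<in> A" and inj: "inj h"
    and return: "\<And>b. b \<in> B \<Longrightarrow> first_hit f (h ` B) (f (h b)) (h (g b))"
    and cover: "\<And>a. a \<in> A \<Longrightarrow> \<exists>b \<in> B. \<exists>n. a = (f ^^ n) (h b)"
  shows "cyclic_on f A \<longleftrightarrow> cyclic_on g B"
proof
  have g_in: "g b \<in> B" if "b \<in> B" for b
    using first_hit_in[OF return[OF that]] inj by (simp add: inj_image_mem_iff)
  have orbit_sub: "Orbits.orbit g b \<subseteq> B" if "b \<in> B" for b
  proof
    fix x assume "x \<in> Orbits.orbit g b"
    then show "x \<in> B" by induction (use that g_in in auto)
  qed
  {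
    assume "cyclic_on f A"
    then have A: "A \<noteq> {}" "\<And>s. s \<in> A \<Longrightarrow> A = Orbits.orbit f s" by (auto simp: cyclic_on_alldef)
    then obtain b where b: "b \<in> B" using cover by blast
    \<comment> \<open>Strong induction on the number of steps of \<open>f\<close>: one step of
      \<open>g\<close> uses up at least one of them, the one that \<open>Suc\<close> counts. If
      nothing is left afterwards, then \<open>b'\<close> is \<open>g b\<close> itself.\<close>
    have "b' \<in> Orbits.orbit g b" if "h b' = (f ^^ Suc n) (h b)" "b \<in> B" "b' \<in> B" for n b b'
      using that
    proof (induction n arbitrary: b rule: less_induct)
      case (less n)
      have "(f ^^ n) (f (h b)) \<in> h ` B"
        using less.prems by (metis funpow_Suc_right comp_apply imageI)
      from first_hit_le[OF return[OF less.prems(2)] this]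
      obtain k where k: "k \<le> n" "h b' = (f ^^ k) (h (g b))"
        using less.prems(1) by (metis funpow_Suc_right comp_apply)
      show ?case
      proof (cases k)
        case 0
        then have "b' = g b" using k inj by (simp add: inj_eq)
        then show ?thesis by (simp add: orbit.base)
      next
        case (Suc j)
        then have "b' \<in> Orbits.orbit g (g b)"
          using less.IH[of j "g b"] k less.prems g_in by auto
        then show ?thesis by (rule orbit_subset)
      qed
    qed
    moreover have "\<exists>n. h b' = (f ^^ Suc n) (h b)" if "b' \<in> B" for b'
    proof -
      have "h b' \<in> Orbits.orbit f (h b)" using A(2)[of "h b"] sub b that by auto
      then show ?thesis unfolding orbit_altdef by (auto simp: gr0_conv_Suc)
    qed
    ultimately have "B = Orbits.orbit g b" using orbit_sub b by blast
    then show "cyclic_on g B" using b cyclic_on_singleI by metis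
  }
  assume "cyclic_on g B"
  then obtain s where s: "s \<in> B" "B = Orbits.orbit g s" by (auto simp: cyclic_on_def)
  have g_orbit: "h (g b) \<in> Orbits.orbit f (h b)" if b: "b \<in> B" for b
  proof -
    obtain n where n: "h (g b) = (f ^^ n) (f (h b))"
      using first_hit_funpow[OF return[OF b]] .
    show ?thesis unfolding n by (intro funpow_in_orbit orbit.base)
  qed
  have reach: "h b \<in> Orbits.orbit f (h s)" if "b \<in> Orbits.orbit g s" for b
    using that
  proof induction
    case base
    then show ?case using g_orbit s by blast
  next
    case (step y)
    then have "h (g y) \<in> Orbits.orbit f (h y)" using g_orbit s by blast
    then show ?case using step.IH orbit_trans by metis
  qed
  have "Orbits.orbit f (h s) \<subseteq> A"
  proof
    fix x assume "x \<in> Orbits.orbit f (h s)"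
    then show "x \<in> A" by induction (use sub s closed in auto)
  qed
  moreover have "A \<subseteq> Orbits.orbit f (h s)"
  proof
    fix a assume "a \<in> A"
    then obtain b n where "b \<in> B" "a = (f ^^ n) (h b)" using cover by blast
    then show "a \<in> Orbits.orbit f (h s)" using reach s funpow_in_orbit by metis
  qed
  ultimately have "A = Orbits.orbit f (h s)" by (rule equalityI[rotated])
  moreover have "h s \<in> A" using sub s by auto
  ultimately show "cyclic_on f A" by (rule cyclic_on_singleI[rotated])
qed

section \<open>Suppression of a degree-one vertex\<close>

lemma local_transitionsD:
  assumes "\<tau> \<in> local_transitions G v"
  shows "bij_betw \<tau> (in_arcs G v) (out_arcs G v)" "\<tau> \<in> extensional (in_arcs G v)"
    "a \<in> arcs G \<Longrightarrow> head G a = v \<Longrightarrow> \<tau> a \<in> arcs G \<and> tail G (\<tau> a) = v"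
proof -
  show *: "bij_betw \<tau> (in_arcs G v) (out_arcs G v)" "\<tau> \<in> extensional (in_arcs G v)"
    using assms by (auto simp: local_transitions_def PiE_def)
  show "a \<in> arcs G \<Longrightarrow> head G a = v \<Longrightarrow> \<tau> a \<in> arcs G \<and> tail G (\<tau> a) = v"
    using bij_betwE[OF *(1)] by auto
qed

lemma local_transitionsI:
  "\<tau> \<in> extensional (in_arcs G v) \<Longrightarrow> bij_betw \<tau> (in_arcs G v) (out_arcs G v) \<Longrightarrow>
    \<tau> \<in> local_transitions G v"
  by (auto simp: local_transitions_def PiE_def dest: bij_betwE)

lemma transition_systems_ext:
  assumes "S \<in> transition_systems G" "T \<in> transition_systems G"
    and "\<And>a. a \<in> arcs G \<Longrightarrow> head G a \<in> verts G \<Longrightarrow> S (head G a) a = T (head G a) a"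
  shows "S = T"
proof (rule PiE_ext)
  show "S \<in> Pi\<^sub>E (verts G) (local_transitions G)" "T \<in> Pi\<^sub>E (verts G) (local_transitions G)"
    using assms(1,2) by (auto simp: transition_systems_def)
  fix v assume v: "v \<in> verts G"
  then have "S v \<in> local_transitions G v" "T v \<in> local_transitions G v"
    using assms(1,2) by (auto simp: transition_systems_def)
  then show "S v = T v"
    using assms(3) v by (intro extensionalityI[of _ "in_arcs G v"]) (auto dest: local_transitionsD)
qed

lemma finite_local_transitions:
  "fin_digraph G \<Longrightarrow> finite (local_transitions G v)"
  unfolding local_transitions_def
  by (rule finite_subset[OF _ finite_PiE[of "in_arcs G v" "\<lambda>_. out_arcs G v"]])
    (auto intro: fin_digraph.finite_in_arcs fin_digraph.finite_out_arcs)

lemma finite_transition_systems: "fin_digraph G \<Longrightarrow> finite (transition_systems G)"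
  unfolding transition_systems_def
  by (intro finite_PiE finite_local_transitions) (auto simp: fin_digraph_def fin_digraph_axioms_def)

lemma finite_ET: "fin_digraph G \<Longrightarrow> finite (ET G)"
  unfolding ET_def by (simp add: finite_transition_systems)

text \<open>This expresses that a transition is forced, and is applied to all vertices other than
  switches and replaced vertices.\<close>

lemma local_transitions_unique:
  assumes "finite (in_arcs G v)" "in_degree G v \<le> 1" "\<sigma> \<in> local_transitions G v" "\<tau> \<in> local_transitions G v"
  shows "\<sigma> = \<tau>"
proof (rule extensionalityI[of _ "in_arcs G v"])
  fix a assume a: "a \<in> in_arcs G v"
  then have "in_arcs G v = {a}"
    using assms(1,2) by (auto simp: in_degree_def card_le_Suc0_iff_eq)
  moreover note local_transitionsD(1)[OF assms(3)] local_transitionsD(1)[OF assms(4)]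
  ultimately have "{\<sigma> a} = {\<tau> a}" by (metis bij_betw_imp_surj_on image_empty image_insert)
  then show "\<sigma> a = \<tau> a" by simp
qed (use assms(3,4) in \<open>auto dest: local_transitionsD\<close>)

section \<open>A single suppression\<close>

locale suppression = fin_digraph G for G :: "('v, 'e) pre_digraph" +
  fixes v
  assumes suppressible: "suppressible G v"
begin

definition "e = the_in_arc G v"
definition "f = the_out_arc G v"

lemma in_arcs_v: "in_arcs G v = {e}" and out_arcs_v: "out_arcs G v = {f}"
  using suppressible unfolding e_def f_def
  by (auto simp: suppressible_def degree_one_def in_degree_def out_degree_def card_1_singleton_iff)

lemma e_neq_f: "e \<noteq> f"
  using suppressible in_arcs_v out_arcs_v by (simp add: suppressible_def)

lemma e: "e \<in> arcs G" "head G e = v" and f: "f \<in> arcs G" "tail G f = v"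
  using in_arcs_v out_arcs_v in_in_arcs_conv[of e G v] in_out_arcs_conv[of f G v] by auto

lemma v: "v \<in> verts G"
  using suppressible by (simp add: suppressible_def)

lemma head_eq_v: "a \<in> arcs G \<Longrightarrow> head G a = v \<longleftrightarrow> a = e"
  using in_arcs_v in_in_arcs_conv[of a G v] by auto

lemma tail_eq_v: "a \<in> arcs G \<Longrightarrow> tail G a = v \<longleftrightarrow> a = f"
  using out_arcs_v in_out_arcs_conv[of a G v] by auto

lemma head_f: "head G f \<noteq> v"
  using head_eq_v f e_neq_f by auto

lemma suppress_simps:
  "verts (suppress G v) = verts G - {v}" "arcs (suppress G v) = arcs G - {f}"
  "tail (suppress G v) = tail G" "head (suppress G v) = (head G)(e := head G f)"
  by (simp_all add: suppress_def e_def f_def)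

lemma out_arcs_suppress: "w \<noteq> v \<Longrightarrow> out_arcs (suppress G v) w = out_arcs G w"
  by (auto simp: suppress_simps f)

lemma in_arcs_suppress:
  "w \<noteq> v \<Longrightarrow> in_arcs (suppress G v) w =
    (if w = head G f then insert e (in_arcs G w - {f}) else in_arcs G w)"
  by (auto simp: suppress_simps e e_neq_f split: if_splits)

text \<open>Only \<open>e\<close> enters and only \<open>f\<close> leaves \<open>v\<close>. Since
  \<open>v\<close> carries no loop, the head of \<open>f\<close> differs from \<open>v\<close>, so
  redirecting \<open>e\<close> to it leaves no dangling end.\<close>

lemma fin_digraph_suppress: "fin_digraph (suppress G v)"
proof
  fix a assume "a \<in> arcs (suppress G v)"
  then show "tail (suppress G v) a \<in> verts (suppress G v)"
    "head (suppress G v) a \<in> verts (suppress G v)"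
    using tail_eq_v[of a] head_eq_v[of a] f head_f by (auto simp: suppress_simps)
qed (auto simp: suppress_simps)

lemma out_degree_suppress: "w \<noteq> v \<Longrightarrow> out_degree (suppress G v) w = out_degree G w"
  by (simp add: out_degree_def out_arcs_suppress)

lemma in_degree_suppress: "w \<noteq> v \<Longrightarrow> in_degree (suppress G v) w = in_degree G w"
proof -
  assume w: "w \<noteq> v"
  have "card (insert e (in_arcs G w - {f})) = card (in_arcs G w)" if "w = head G f"
  proof -
    have "e \<notin> in_arcs G w - {f}" using w e by auto
    moreover have "f \<in> in_arcs G w" using f that by auto
    ultimately show ?thesis
      by (metis card.remove card_insert_disjoint finite_in_arcs finite_Diff)
  qed
  then show ?thesis using w by (simp add: in_degree_def in_arcs_suppress)
qed

text \<open>Inverse of \<open>unsuppress\<close>: the merged arc, still named \<open>e\<close>,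
  takes over the transition of \<open>f\<close>, and the transition at \<open>v\<close> is
  forgotten.\<close>

definition push where
  "push T = (\<lambda>w \<in> verts (suppress G v). \<lambda>a \<in> in_arcs (suppress G v) w. if a = e then T w f else T w a)"

lemma bij_betw_relabel:
  "w \<noteq> v \<Longrightarrow> bij_betw (\<lambda>a. if a = f then e else a) (in_arcs G w) (in_arcs (suppress G v) w)"
  by (rule bij_betw_byWitness[where f' = "\<lambda>a. if a = e then (if w = head G f then f else e) else a"])
    (auto simp: suppress_simps e e_neq_f f split: if_splits)

lemma unsuppress_apply:
  assumes "w \<in> verts G" "a \<in> arcs G" "head G a = w"
  shows "unsuppress G v T w a = (if w = v then f else if a = f then T w e else T w a)"
  using assms by (simp add: unsuppress_def e_def f_def)

lemma unsuppress_transition_systems: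
  assumes T: "T \<in> transition_systems (suppress G v)"
  shows "unsuppress G v T \<in> transition_systems G"
  unfolding transition_systems_def
proof (rule PiE_I)
  fix w assume w: "w \<in> verts G"
  show "unsuppress G v T w \<in> local_transitions G w"
  proof (rule local_transitionsI)
    show "unsuppress G v T w \<in> extensional (in_arcs G w)"
      using w by (simp add: unsuppress_def)
    show "bij_betw (unsuppress G v T w) (in_arcs G w) (out_arcs G w)"
    proof (cases "w = v")
      case True
      then show ?thesis
        using w by (simp add: in_arcs_v out_arcs_v unsuppress_apply e v)
    next
      case False
      then have "T w \<in> local_transitions (suppress G v) w"
        using T w by (auto simp: transition_systems_def suppress_simps)
      then have "bij_betw (T w \<circ> (\<lambda>a. if a = f then e else a)) (in_arcs G w) (out_arcs G w)"
        using bij_betw_trans[OF bij_betw_relabel[OF False] local_transitionsD(1)] out_arcs_suppress[OF False]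
        by simp
      then show ?thesis
        using w False by (subst bij_betw_cong) (auto simp: unsuppress_apply)
    qed
  qed
qed (simp add: unsuppress_def)

lemma push_transition_systems:
  assumes T: "T \<in> transition_systems G"
  shows "push T \<in> transition_systems (suppress G v)"
  unfolding transition_systems_def
proof (rule PiE_I)
  fix w assume w: "w \<in> verts (suppress G v)"
  then have wv: "w \<noteq> v" "w \<in> verts G" by (auto simp: suppress_simps)
  show "push T w \<in> local_transitions (suppress G v) w"
  proof (rule local_transitionsI)
    show "push T w \<in> extensional (in_arcs (suppress G v) w)"
      using w by (simp add: push_def)
    have *: "bij_betw (\<lambda>a. if a = e then f else a) (in_arcs (suppress G v) w) (in_arcs G w)"
      by (rule bij_betw_byWitness[where f' = "\<lambda>a. if a = f then e else a"])
        (use wv in \<open>auto simp: suppress_simps e e_neq_f f split: if_splits\<close>)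
    have "T w \<in> local_transitions G w"
      using T wv by (auto simp: transition_systems_def)
    then have "bij_betw (T w \<circ> (\<lambda>a. if a = e then f else a))
        (in_arcs (suppress G v) w) (out_arcs (suppress G v) w)"
      using bij_betw_trans[OF * local_transitionsD(1)] out_arcs_suppress[OF wv(1)] by simp
    then show "bij_betw (push T w) (in_arcs (suppress G v) w) (out_arcs (suppress G v) w)"
      using w by (subst bij_betw_cong) (auto simp: push_def)
  qed
qed (simp add: push_def)

lemma bij_betw_unsuppress_transition_systems:
  "bij_betw (unsuppress G v) (transition_systems (suppress G v)) (transition_systems G)"
proof (rule bij_betw_byWitness[where f' = push])
  show "\<forall>T \<in> transition_systems (suppress G v). push (unsuppress G v T) = T"
  proof
    fix T assume T: "T \<in> transition_systems (suppress G v)"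
    show "push (unsuppress G v T) = T"
    proof (rule transition_systems_ext[of _ "suppress G v"])
      fix a assume "a \<in> arcs (suppress G v)"
      then show "push (unsuppress G v T) (head (suppress G v) a) a = T (head (suppress G v) a) a"
        using e f head_f e_neq_f head_eq_v[of a]
        by (auto simp: push_def suppress_simps unsuppress_apply)
    qed (use T in \<open>auto intro: push_transition_systems unsuppress_transition_systems\<close>)
  qed
  show "\<forall>T \<in> transition_systems G. unsuppress G v (push T) = T"
  proof
    fix T assume T: "T \<in> transition_systems G"
    show "unsuppress G v (push T) = T"
    proof (rule transition_systems_ext[of _ G])
      fix a assume a: "a \<in> arcs G"
      \<comment> \<open>The transition at \<open>v\<close> is the only information that
        \<open>push\<close> drops, and it is forced.\<close>
      have "T v e = f"
        using T v e tail_eq_v by (metis PiE_mem local_transitionsD(3) transition_systems_def)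
      then show "unsuppress G v (push T) (head G a) a = T (head G a) a"
        using a e f head_f e_neq_f head_eq_v[of a]
        by (auto simp: push_def suppress_simps unsuppress_apply)
    qed (use T in \<open>auto intro: push_transition_systems unsuppress_transition_systems\<close>)
  qed
qed (auto intro: push_transition_systems unsuppress_transition_systems)

lemma arc_perm_closed:
  assumes "T \<in> transition_systems G" "a \<in> arcs G"
  shows "arc_perm G T a \<in> arcs G"
  using assms by (auto simp: arc_perm_def transition_systems_def dest!: PiE_mem local_transitionsD(3))

text \<open>The large arc permutation sends \<open>e\<close> to \<open>f\<close> and then
  \<open>f\<close> to the image of the merged arc; all other arcs agree. Hence the small one is its
  first-return map to the arcs other than \<open>f\<close>.\<close>

lemma cyclic_on_unsuppress:
  assumes T: "T \<in> transition_systems (suppress G v)"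
  shows "cyclic_on (arc_perm G (unsuppress G v T)) (arcs G) \<longleftrightarrow>
    cyclic_on (arc_perm (suppress G v) T) (arcs (suppress G v))"
proof (rule cyclic_on_first_return[where h = id])
  let ?T = "unsuppress G v T"
  have perm_e: "arc_perm G ?T e = f" using e v by (simp add: arc_perm_def unsuppress_apply)
  have perm_f: "arc_perm G ?T f = arc_perm (suppress G v) T e"
    using f e e_neq_f head_f by (simp add: arc_perm_def unsuppress_apply suppress_simps)
  have perm: "arc_perm G ?T a = arc_perm (suppress G v) T a" if "a \<in> arcs G" "a \<noteq> e" "a \<noteq> f" for a
    using that head_eq_v[of a] by (simp add: arc_perm_def unsuppress_apply suppress_simps)
  interpret S: fin_digraph "suppress G v" by (rule fin_digraph_suppress)
  have closed: "arc_perm (suppress G v) T a \<in> arcs (suppress G v)" if "a \<in> arcs (suppress G v)" for a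
    using T that
    by (auto simp: arc_perm_def transition_systems_def dest!: PiE_mem local_transitionsD(3))
  fix b assume b: "b \<in> arcs (suppress G v)"
  show "first_hit (arc_perm G ?T) (id ` arcs (suppress G v)) (arc_perm G ?T (id b))
          (id (arc_perm (suppress G v) T b))"
  proof (cases "b = e")
    case True
    have "f \<notin> arcs (suppress G v)" by (simp add: suppress_simps)
    then show ?thesis
      using closed[OF b] by (simp add: True perm_e perm_f first_hit.here first_hit.step)
  next
    case False
    then show ?thesis using b closed[OF b] perm[of b] by (simp add: suppress_simps first_hit.here)
  qed
next
  let ?p = "arc_perm G (unsuppress G v T)"
  fix a assume a: "a \<in> arcs G"
  show "\<exists>b \<in> arcs (suppress G v). \<exists>n. a = (?p ^^ n) (id b)"
  proof (cases "a = f")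
    case True
    have "f = (?p ^^ 1) (id e)" using e v by (simp add: arc_perm_def unsuppress_apply)
    moreover have "e \<in> arcs (suppress G v)" by (simp add: suppress_simps e e_neq_f)
    ultimately show ?thesis using True by blast
  next
    case False
    have "a = (?p ^^ 0) (id a)" by simp
    moreover have "a \<in> arcs (suppress G v)" using a False by (simp add: suppress_simps)
    ultimately show ?thesis by blast
  qed
qed (auto simp: suppress_simps intro: arc_perm_closed unsuppress_transition_systems T)

lemma bij_betw_unsuppress: "bij_betw (unsuppress G v) (ET (suppress G v)) (ET G)"
proof -
  let ?D = "ET (suppress G v)"
  have "bij_betw (unsuppress G v) ?D (unsuppress G v ` ?D)"
    using bij_betw_unsuppress_transition_systems
    by (auto simp: ET_def intro: inj_on_imp_bij_betw inj_on_subset bij_betw_imp_inj_on)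
  moreover have "unsuppress G v ` ?D = ET G"
  proof (intro equalityI subsetI)
    fix T assume "T \<in> ET G"
    then obtain S where "S \<in> transition_systems (suppress G v)" "T = unsuppress G v S"
      using bij_betw_unsuppress_transition_systems by (auto simp: ET_def bij_betw_def)
    then show "T \<in> unsuppress G v ` ?D"
      using \<open>T \<in> ET G\<close> cyclic_on_unsuppress by (auto simp: ET_def)
  qed (auto simp: ET_def cyclic_on_unsuppress unsuppress_transition_systems)
  ultimately show ?thesis by simp
qed

end

text \<open>Carries finiteness along the sequence, so that each step takes place inside the locale
  \<open>suppression\<close>.\<close>

lemma suppression_sequence_induct [consumes 2, case_names Nil Cons]:
  assumes "fin_digraph G" "suppression_sequence G vs"
    and "\<And>G. fin_digraph G \<Longrightarrow> P G []"
    and "\<And>G v vs. suppression G v \<Longrightarrow> suppression_sequence (suppress G v) vs \<Longrightarrow>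
      P (suppress G v) vs \<Longrightarrow> P G (v # vs)"
  shows "P G vs"
  using assms(1,2)
proof (induction vs arbitrary: G)
  case (Cons v vs)
  then interpret suppression G v
    by (auto simp: suppression_def suppression_axioms_def)
  show ?case
    using Cons fin_digraph_suppress by (intro assms(4)) (auto intro: suppression_axioms)
qed (rule assms(3))

lemma suppress_all_facts:
  assumes "fin_digraph G" "suppression_sequence G vs"
  shows fin_digraph_suppress_all: "fin_digraph (suppress_all G vs)"
    and verts_suppress_all: "verts (suppress_all G vs) = verts G - set vs"
    and arcs_suppress_all: "arcs (suppress_all G vs) \<subseteq> arcs G"
    and degrees_suppress_all: "\<forall>w. w \<notin> set vs \<longrightarrow>
      in_degree (suppress_all G vs) w = in_degree G w \<and> out_degree (suppress_all G vs) w = out_degree G w"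
    and bij_betw_unsuppress_all: "bij_betw (unsuppress_all G vs) (ET (suppress_all G vs)) (ET G)"
    and degree_one_suppressed: "\<forall>w \<in> set vs. degree_one G w"
proof -
  show "fin_digraph (suppress_all G vs)"
    using assms by (induction rule: suppression_sequence_induct) auto
  show "verts (suppress_all G vs) = verts G - set vs"
    using assms by (induction rule: suppression_sequence_induct) (auto simp: suppression.suppress_simps)
  show "arcs (suppress_all G vs) \<subseteq> arcs G"
    using assms by (induction rule: suppression_sequence_induct) (auto simp: suppression.suppress_simps)
  show "\<forall>w. w \<notin> set vs \<longrightarrow>
      in_degree (suppress_all G vs) w = in_degree G w \<and> out_degree (suppress_all G vs) w = out_degree G w"
    using assms by (induction rule: suppression_sequence_induct) (auto simp: suppression.in_degree_suppress suppression.out_degree_suppress)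
  \<comment> \<open>A suppression preserves the degrees of the other vertices, so a vertex
    suppressed late had degree one from the start.\<close>
  show "\<forall>w \<in> set vs. degree_one G w"
  using assms
  proof (induction rule: suppression_sequence_induct)
    case (Cons G v vs)
    then interpret suppression G v by simp
    show ?case using Cons suppressible in_degree_suppress out_degree_suppress
      by (auto simp: degree_one_def suppressible_def) metis+
  qed simp
  show "bij_betw (unsuppress_all G vs) (ET (suppress_all G vs)) (ET G)"
  using assms
  proof (induction rule: suppression_sequence_induct)
    case (Nil G)
    then show ?case by (auto simp: bij_betw_def)
  next
    case (Cons G v vs)
    have "unsuppress_all G (v # vs) = unsuppress G v \<circ> unsuppress_all (suppress G v) vs"
      by (simp add: fun_eq_iff)
    then show ?case
      using bij_betw_trans[OF Cons.IH suppression.bij_betw_unsuppress[OF Cons.hyps(1)]]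
      by (simp add: comp_def)
  qed
qed

section \<open>Switching networks\<close>

definition switch_perm :: "nat set \<Rightarrow> bool \<Rightarrow> nat \<Rightarrow> nat" where
  "switch_perm p b = (if b then Transposition.transpose (Min p) (Max p) else id)"

lemma net_perm_Cons: "net_perm (p # ps) (b # bs) = net_perm ps bs \<circ> switch_perm p b"
  by (simp add: switch_perm_def)

lemma switch_perm_involutory [simp]: "switch_perm p b (switch_perm p b i) = i"
  by (simp add: switch_perm_def)

lemma two_element_Min_Max:
  assumes "card p = 2"
  shows "Min p \<noteq> Max p" "p = {Min p, Max p :: 'a :: linorder}"
proof -
  obtain x y where p: "p = {x, y}" "x \<noteq> y" using assms by (auto simp: card_2_iff)
  show "Min p \<noteq> Max p" "p = {Min p, Max p}"
    using p by (auto simp: min_def max_def)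
qed

lemma switch_perm_permutes: "card p = 2 \<Longrightarrow> switch_perm p b permutes p"
  using two_element_Min_Max[of p] by (auto simp: switch_perm_def permutes_id intro!: permutes_swap_id)

lemma switch_perm_in_iff: "card p = 2 \<Longrightarrow> switch_perm p b i \<in> p \<longleftrightarrow> i \<in> p"
  by (simp add: permutes_in_image switch_perm_permutes)

lemma switch_perm_outside: "card p = 2 \<Longrightarrow> i \<notin> p \<Longrightarrow> switch_perm p b i = i"
  using switch_perm_permutes by (metis permutes_def)

text \<open>A crossed switch moves both of its wires and a straight one moves none, so one incoming
  segment already reveals the setting.\<close>

lemma switch_perm_moves: "card p = 2 \<Longrightarrow> i \<in> p \<Longrightarrow> switch_perm p b i \<noteq> i \<longleftrightarrow> b"
  using two_element_Min_Max[of p] by (auto simp: switch_perm_def transpose_eq_iff)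

lemma net_perm_permutes:
  assumes "\<And>p. p \<in> set ps \<Longrightarrow> p \<subseteq> A \<and> card p = 2"
  shows "net_perm ps bs permutes A"
  using assms
proof (induction ps bs rule: net_perm.induct)
  case (1 p ps b bs)
  then have "switch_perm p b permutes A"
    by (meson list.set_intros(1) permutes_subset switch_perm_permutes)
  then show ?case
    unfolding net_perm_Cons using 1 by (intro permutes_compose) auto
qed (auto simp: permutes_id[unfolded id_def] permutes_id)

text \<open>Translates gadget probabilities into numbers of settings, the form in which fibres are
  counted.\<close>

lemma pmf_switching_distribution:
  "pmf (switching_distribution ps) \<sigma> =
    real (card {bs. length bs = length ps \<and> net_perm ps bs = \<sigma>}) / 2 ^ length ps"
proof -
  let ?L = "{bs :: bool list. length bs = length ps}"
  have L: "finite ?L" "card ?L = 2 ^ length ps"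
    using finite_lists_length_eq[of "UNIV :: bool set" "length ps"]
      card_lists_length_eq[of "UNIV :: bool set" "length ps"] by auto
  have "?L \<noteq> {}" using L(2) by (metis card.empty power_not_zero zero_neq_numeral)
  moreover have "?L \<inter> net_perm ps -` {\<sigma>} = {bs. length bs = length ps \<and> net_perm ps bs = \<sigma>}"
    by auto
  ultimately show ?thesis
    using L by (simp add: switching_distribution_def pmf_map measure_pmf_of_set)
qed

text \<open>Just before switch k, the signal on wire i is on segment number \<open>segment_before ps i k\<close>.\<close>

primrec segment_before :: "nat set list \<Rightarrow> nat \<Rightarrow> nat \<Rightarrow> nat" where
  "segment_before ps i 0 = 0"
| "segment_before ps i (Suc k) = (if i \<in> ps ! k then Suc k else segment_before ps i k)"

lemma segment_before_le: "segment_before ps i k \<le> k"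
  by (induction k) auto

lemma segment_before_cases:
  "segment_before ps i k = 0 \<or> (\<exists>j < k. segment_before ps i k = Suc j \<and> i \<in> ps ! j)"
  by (induction k) (auto intro: less_SucI)

text \<open>The assumption says that wire \<open>i\<close> has a segment numbered \<open>t\<close>.
  It is the current one before switch \<open>k\<close> iff it has started and no switch on the wire
  has ended it yet.\<close>

lemma segment_before_eq_iff:
  assumes "t = 0 \<or> (\<exists>j. t = Suc j \<and> i \<in> ps ! j)"
  shows "t = segment_before ps i k \<longleftrightarrow> t \<le> k \<and> (\<forall>j. t \<le> j \<longrightarrow> j < k \<longrightarrow> i \<notin> ps ! j)"
proof (induction k)
  case 0
  then show ?case by auto
next
  case (Suc k)
  show ?case
  proof (cases "i \<in> ps ! k")
    case True
    then show ?thesis by (auto simp: not_le dest: spec[of _ k] intro: le_antisym)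
  next
    case False
    show ?thesis
    proof (cases "t = Suc k")
      case True
      then show ?thesis using False assms segment_before_le[of ps i k] by auto
    next
      case False
      then show ?thesis using Suc \<open>i \<notin> ps ! k\<close> by (auto simp: less_Suc_eq)
    qed
  qed
qed

text \<open>Reconciles two descriptions of a segment: \<open>next_vert\<close> looks forward to the
  next switch on the wire, \<open>segment_before\<close> back to the last one. This identifies the
  incoming segments of a switch.\<close>

lemma next_vert_eq_Switch:
  assumes "t = 0 \<or> (\<exists>j. t = Suc j \<and> i \<in> ps ! j)"
  shows "next_vert ps v i t = Switch u k \<longleftrightarrow>
    u = v \<and> k < length ps \<and> i \<in> ps ! k \<and> t = segment_before ps i k"
proof -
  let ?Q = "\<lambda>k. t \<le> k \<and> k < length ps \<and> i \<in> ps ! k"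
  have "(\<exists>k. ?Q k) \<and> (LEAST k. ?Q k) = k \<longleftrightarrow> ?Q k \<and> (\<forall>j. ?Q j \<longrightarrow> k \<le> j)"
    using LeastI_ex[of ?Q] Least_le[of ?Q] Least_equality[of ?Q k] by blast
  moreover have "?Q k \<and> (\<forall>j. ?Q j \<longrightarrow> k \<le> j) \<longleftrightarrow>
      k < length ps \<and> i \<in> ps ! k \<and> t = segment_before ps i k"
    unfolding segment_before_eq_iff[OF assms] by (auto simp: not_le[symmetric])
  ultimately show ?thesis by (auto simp: next_vert_def)
qed

text \<open>The bound on \<open>j\<close> matters: a segment number beyond the last switch would
  also lead to the output port, but \<open>segment_before\<close> never exceeds
  \<open>length ps\<close>.\<close>

lemma next_vert_eq_OutPort:
  assumes "t = 0 \<or> (\<exists>j < length ps. t = Suc j \<and> i \<in> ps ! j)"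
  shows "next_vert ps v i t = OutPort u j \<longleftrightarrow>
    u = v \<and> j = i \<and> t = segment_before ps i (length ps)"
proof -
  have "t = 0 \<or> (\<exists>j. t = Suc j \<and> i \<in> ps ! j)" "t \<le> length ps" using assms by auto
  then show ?thesis by (auto simp: next_vert_def segment_before_eq_iff)
qed

lemma next_vert_neq [simp]: "next_vert ps v i t \<noteq> InPort u j" "next_vert ps v i t \<noteq> Orig u"
  by (auto simp: next_vert_def)

section \<open>The graph with gadgets inserted\<close>

text \<open>The combinatorial content of \<open>valid_construction\<close>. The counting works for
  arbitrary lists of two-wire switches; probabilities enter later through
  \<open>pointwise_bound\<close>, and lengths through the size estimate.\<close>

locale gadget_insertion =
  fixes G :: "('v, 'e) pre_digraph" and c :: "('v, 'e) construction"
  assumes fin: "fin_digraph (reduced G c)"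
    and balanced: "v \<in> verts (reduced G c) \<Longrightarrow> in_degree (reduced G c) v = out_degree (reduced G c) v"
    and switches: "v \<in> V_ge2 G c \<Longrightarrow> p \<in> set (network c v) \<Longrightarrow> p \<subseteq> {..<deg G c v} \<and> card p = 2"
    and in_port: "v \<in> V_ge2 G c \<Longrightarrow> bij_betw (in_port c) (in_arcs (reduced G c) v) {..<deg G c v}"
    and out_port: "v \<in> V_ge2 G c \<Longrightarrow> bij_betw (out_port c) (out_arcs (reduced G c) v) {..<deg G c v}"
begin

abbreviation "H \<equiv> reduced G c"
abbreviation "W \<equiv> V_ge2 G c"
abbreviation "P \<equiv> port_graph G c"

sublocale H: fin_digraph H by (rule fin)

section \<open>Port assignments, segments and incidences\<close>

definition "in_ext v = inv_into (in_arcs H v) (in_port c)"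
definition "out_ext v = inv_into (out_arcs H v) (out_port c)"

lemma W_verts: "v \<in> W \<Longrightarrow> v \<in> verts H"
  by (simp add: V_ge2_def)

lemma finite_W: "finite W"
  by (rule finite_subset[OF _ H.finite_verts]) (auto simp: V_ge2_def)

lemma nth_switch: "v \<in> W \<Longrightarrow> k < length (network c v) \<Longrightarrow>
    network c v ! k \<subseteq> {..<deg G c v} \<and> card (network c v ! k) = 2"
  by (simp add: switches)

lemma in_ext:
  assumes "v \<in> W" "i < deg G c v"
  shows "in_ext v i \<in> arcs H" "head H (in_ext v i) = v" "in_port c (in_ext v i) = i"
proof -
  have "i \<in> in_port c ` in_arcs H v" using in_port[OF assms(1)] assms(2) by (simp add: bij_betw_def)
  then show "in_ext v i \<in> arcs H" "head H (in_ext v i) = v" "in_port c (in_ext v i) = i"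
    using inv_into_into[of i "in_port c" "in_arcs H v"] by (auto simp: in_ext_def f_inv_into_f)
qed

lemma out_ext:
  assumes "v \<in> W" "i < deg G c v"
  shows "out_ext v i \<in> arcs H" "tail H (out_ext v i) = v" "out_port c (out_ext v i) = i"
proof -
  have "i \<in> out_port c ` out_arcs H v" using out_port[OF assms(1)] assms(2) by (simp add: bij_betw_def)
  then show "out_ext v i \<in> arcs H" "tail H (out_ext v i) = v" "out_port c (out_ext v i) = i"
    using inv_into_into[of i "out_port c" "out_arcs H v"] by (auto simp: out_ext_def f_inv_into_f)
qed

lemma in_port_in_ext:
  assumes "e \<in> arcs H" "head H e \<in> W"
  shows "in_ext (head H e) (in_port c e) = e" "in_port c e < deg G c (head H e)"
  using in_port[OF assms(2)] assms(1)
  by (auto simp: in_ext_def bij_betw_def intro!: inv_into_f_f)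

lemma out_port_out_ext:
  assumes "e \<in> arcs H" "tail H e \<in> W"
  shows "out_ext (tail H e) (out_port c e) = e" "out_port c e < deg G c (tail H e)"
  using out_port[OF assms(2)] assms(1)
  by (auto simp: out_ext_def bij_betw_def intro!: inv_into_f_f)

text \<open>Names segments by time: consecutive \<open>k\<close> give the same segment while no
  switch touches wire \<open>i\<close>. Signals can thus be followed by induction on the switches,
  whichever wires these act on.\<close>

definition segment :: "'v \<Rightarrow> nat \<Rightarrow> nat \<Rightarrow> ('v, 'e) net_arc" where
  "segment v i k = Seg v i (segment_before (network c v) i k)"

lemma wire_segment [simp]: "wire (segment v i k) = i"
  by (simp add: segment_def)

lemma verts_P:
  "Orig v \<in> verts P \<longleftrightarrow> v \<in> verts H \<and> v \<notin> W"
  "InPort v i \<in> verts P \<longleftrightarrow> v \<in> W \<and> i < deg G c v"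
  "OutPort v i \<in> verts P \<longleftrightarrow> v \<in> W \<and> i < deg G c v"
  "Switch v k \<in> verts P \<longleftrightarrow> v \<in> W \<and> k < length (network c v)"
  by (auto simp: port_graph_def Let_def ports_def)

lemma Ext_in_arcs: "Ext e \<in> arcs P \<longleftrightarrow> e \<in> arcs H"
  by (auto simp: port_graph_def Let_def)

lemma Seg_in_arcs: "Seg v i t \<in> arcs P \<longleftrightarrow>
    v \<in> W \<and> i < deg G c v \<and> (t = 0 \<or> (\<exists>k < length (network c v). t = Suc k \<and> i \<in> network c v ! k))"
  using nth_switch by (fastforce simp: port_graph_def Let_def)

lemma ends_P:
  "tail P (Ext e) = (if tail H e \<in> W then OutPort (tail H e) (out_port c e) else Orig (tail H e))"
  "tail P (Seg v i 0) = InPort v i" "tail P (Seg v i (Suc k)) = Switch v k"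
  "head P (Ext e) = (if head H e \<in> W then InPort (head H e) (in_port c e) else Orig (head H e))"
  "head P (Seg v i t) = next_vert (network c v) v i t"
  by (auto simp: port_graph_def Let_def)

lemma arcs_P_cases:
  assumes "a \<in> arcs P"
  obtains e where "a = Ext e" "e \<in> arcs H"
  | v i where "a = Seg v i 0" "v \<in> W" "i < deg G c v"
  | v i k where "a = Seg v i (Suc k)" "v \<in> W" "i < deg G c v" "k < length (network c v)" "i \<in> network c v ! k"
  using assms by (cases a) (auto simp: Ext_in_arcs Seg_in_arcs)

lemma segment_in_arcs:
  assumes "v \<in> W" "i < deg G c v" "k \<le> length (network c v)"
  shows "segment v i k \<in> arcs P"
  using segment_before_cases[of "network c v" i k] assms by (fastforce simp: segment_def Seg_in_arcs)

lemma head_Seg_eq_Switch: "Seg v i t \<in> arcs P \<Longrightarrow> head P (Seg v i t) = Switch u k \<longleftrightarrow>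
    u = v \<and> k < length (network c v) \<and> i \<in> network c v ! k \<and> Seg v i t = segment v i k"
  unfolding Seg_in_arcs ends_P segment_def
  by (subst next_vert_eq_Switch) auto

lemma head_Seg_eq_OutPort: "Seg v i t \<in> arcs P \<Longrightarrow> head P (Seg v i t) = OutPort u j \<longleftrightarrow>
    u = v \<and> j = i \<and> Seg v i t = segment v i (length (network c v))"
  unfolding Seg_in_arcs ends_P segment_def
  by (subst next_vert_eq_OutPort) auto

lemma in_arcs_Switch:
  assumes "v \<in> W" "k < length (network c v)"
  shows "in_arcs P (Switch v k) = (\<lambda>i. segment v i k) ` (network c v ! k)"
proof (intro equalityI subsetI)
  fix a assume "a \<in> in_arcs P (Switch v k)"
  then show "a \<in> (\<lambda>i. segment v i k) ` (network c v ! k)"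
    by (cases a) (auto simp: head_Seg_eq_Switch ends_P(4) split: if_splits)
next
  fix a assume "a \<in> (\<lambda>i. segment v i k) ` (network c v ! k)"
  then obtain i where i: "i \<in> network c v ! k" "a = segment v i k" by auto
  moreover from this have "segment v i k \<in> arcs P"
    using nth_switch[OF assms] assms by (intro segment_in_arcs) auto
  ultimately show "a \<in> in_arcs P (Switch v k)"
    using assms head_Seg_eq_Switch[of v i "segment_before (network c v) i k" v k]
    by (auto simp: segment_def)
qed

lemma out_arcs_Switch:
  assumes "v \<in> W" "k < length (network c v)"
  shows "out_arcs P (Switch v k) = (\<lambda>i. Seg v i (Suc k)) ` (network c v ! k)"
  using assms nth_switch[OF assms]
  by (auto simp: Seg_in_arcs ends_P elim!: arcs_P_cases split: if_splits)

lemma in_arcs_InPort: "v \<in> W \<Longrightarrow> i < deg G c v \<Longrightarrow> in_arcs P (InPort v i) = {Ext (in_ext v i)}"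
  by (auto simp: Ext_in_arcs ends_P in_ext in_port_in_ext elim!: arcs_P_cases split: if_splits)

lemma out_arcs_InPort: "v \<in> W \<Longrightarrow> i < deg G c v \<Longrightarrow> out_arcs P (InPort v i) = {Seg v i 0}"
  by (auto simp: Seg_in_arcs ends_P elim!: arcs_P_cases split: if_splits)

lemma in_arcs_OutPort:
  assumes "v \<in> W" "i < deg G c v"
  shows "in_arcs P (OutPort v i) = {segment v i (length (network c v))}"
proof -
  have "a = segment v i (length (network c v))" if "a \<in> in_arcs P (OutPort v i)" for a
    using that by (cases a) (auto simp: head_Seg_eq_OutPort ends_P(4) split: if_splits)
  moreover have "segment v i (length (network c v)) \<in> in_arcs P (OutPort v i)"
    using segment_in_arcs[OF assms, of "length (network c v)"]
      head_Seg_eq_OutPort[of v i "segment_before (network c v) i (length (network c v))" v i]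
    by (simp add: segment_def)
  ultimately show ?thesis by blast
qed

lemma out_arcs_OutPort: "v \<in> W \<Longrightarrow> i < deg G c v \<Longrightarrow> out_arcs P (OutPort v i) = {Ext (out_ext v i)}"
  by (auto simp: Ext_in_arcs ends_P out_ext out_port_out_ext elim!: arcs_P_cases split: if_splits)

lemma in_arcs_Orig: "v \<in> verts H \<Longrightarrow> v \<notin> W \<Longrightarrow> in_arcs P (Orig v) = Ext ` in_arcs H v"
  by (auto simp: Ext_in_arcs ends_P elim!: arcs_P_cases split: if_splits)

lemma out_arcs_Orig: "v \<in> verts H \<Longrightarrow> v \<notin> W \<Longrightarrow> out_arcs P (Orig v) = Ext ` out_arcs H v"
  by (auto simp: Ext_in_arcs ends_P elim!: arcs_P_cases split: if_splits)

lemma fin_digraph_P: "fin_digraph P"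
proof
  let ?S = "(\<lambda>(v, i, t). Seg v i t) ` (SIGMA v : W. {..<deg G c v} \<times> {..length (network c v)})"
  have "finite ?S" using finite_W by blast
  then have "finite (Ext ` arcs H \<union> ?S)" by simp
  moreover have "arcs P \<subseteq> Ext ` arcs H \<union> ?S"
  proof
    fix a assume "a \<in> arcs P"
    then show "a \<in> Ext ` arcs H \<union> ?S"
    proof (cases rule: arcs_P_cases)
      case (2 v i)
      then show ?thesis by (intro UnI2 image_eqI[of _ _ "(v, i, 0)"]) simp_all
    next
      case (3 v i k)
      then show ?thesis by (intro UnI2 image_eqI[of _ _ "(v, i, Suc k)"]) simp_all
    qed blast
  qed
  ultimately show "finite (arcs P)"
    by (rule finite_subset[rotated])
  show "finite (verts P)"
    using finite_W by (auto simp: port_graph_def Let_def ports_def)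
  fix a assume a: "a \<in> arcs P"
  then show "tail P a \<in> verts P"
    by (cases rule: arcs_P_cases) (auto simp: ends_P verts_P out_port_out_ext)
  show "head P a \<in> verts P"
  proof (cases a)
    case (Ext e)
    then show ?thesis using a by (auto simp: ends_P verts_P in_port_in_ext Ext_in_arcs)
  next
    case (Seg v i t)
    have s: "Seg v i t \<in> arcs P" using a Seg by simp
    then have "v \<in> W" "i < deg G c v" by (auto simp: Seg_in_arcs)
    moreover have "(\<exists>u k. head P (Seg v i t) = Switch u k) \<or> (\<exists>u j. head P (Seg v i t) = OutPort u j)"
      by (simp add: ends_P next_vert_def)
    ultimately show ?thesis
      unfolding Seg
    proof (elim disjE exE)
      fix u k assume "head P (Seg v i t) = Switch u k"
      then show "head P (Seg v i t) \<in> verts P"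
        using \<open>v \<in> W\<close> head_Seg_eq_Switch[OF s, of u k] by (simp add: verts_P)
    next
      fix u j assume "head P (Seg v i t) = OutPort u j"
      then show "head P (Seg v i t) \<in> verts P"
        using \<open>v \<in> W\<close> \<open>i < deg G c v\<close> head_Seg_eq_OutPort[OF s, of u j] by (simp add: verts_P)
    qed
  qed
qed

sublocale P: fin_digraph P by (rule fin_digraph_P)

lemma low_degree:
  assumes "v \<in> verts H" "v \<notin> W"
  shows "in_degree H v \<le> 1" "out_degree H v = in_degree H v"
  using assms balanced[of v] by (auto simp: V_ge2_def)

text \<open>Ports have one arc in and one out, and surviving original vertices have equal degrees at
  most one. All freedom therefore sits in the switches.\<close>

lemma forced_vertex:
  assumes "u \<in> verts P" "\<And>v k. u \<noteq> Switch v k"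
  shows "card (in_arcs P u) \<le> 1" "card (out_arcs P u) = card (in_arcs P u)"
proof -
  have "card (in_arcs P u) \<le> 1 \<and> card (out_arcs P u) = card (in_arcs P u)"
  proof (cases u)
    case (Orig v)
    then show ?thesis
      using assms low_degree[of v]
      by (simp add: verts_P in_arcs_Orig out_arcs_Orig card_image inj_on_def in_degree_def out_degree_def)
  qed (use assms in \<open>auto simp: verts_P in_arcs_InPort out_arcs_InPort in_arcs_OutPort out_arcs_OutPort\<close>)
  then show "card (in_arcs P u) \<le> 1" "card (out_arcs P u) = card (in_arcs P u)" by auto
qed

subsection \<open>Transition systems and switch settings\<close>

lemma transitionD:
  assumes "T \<in> transition_systems P" "a \<in> arcs P"
  shows "T (head P a) \<in> local_transitions P (head P a)" "T (head P a) a \<in> arcs P"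
    "tail P (T (head P a) a) = head P a"
proof -
  show *: "T (head P a) \<in> local_transitions P (head P a)"
    using assms(1) P.head_in_verts[OF assms(2)] unfolding transition_systems_def by (rule PiE_mem)
  show "T (head P a) a \<in> arcs P" "tail P (T (head P a) a) = head P a"
    using local_transitionsD(3)[OF * assms(2) refl] by auto
qed

lemma T_InPort:
  assumes T: "T \<in> transition_systems P" and v: "v \<in> W" "i < deg G c v"
  shows "T (InPort v i) (Ext (in_ext v i)) = Seg v i 0"
proof -
  have "Ext (in_ext v i) \<in> in_arcs P (InPort v i)" using in_arcs_InPort v by simp
  then have "T (InPort v i) (Ext (in_ext v i)) \<in> out_arcs P (InPort v i)"
    using transitionD[OF T, of "Ext (in_ext v i)"] by simp
  then show ?thesis using out_arcs_InPort v by simp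
qed

lemma T_OutPort:
  assumes T: "T \<in> transition_systems P" and v: "v \<in> W" "i < deg G c v"
  shows "T (OutPort v i) (segment v i (length (network c v))) = Ext (out_ext v i)"
proof -
  let ?s = "segment v i (length (network c v))"
  have "?s \<in> in_arcs P (OutPort v i)" using in_arcs_OutPort v by simp
  then have "T (OutPort v i) ?s \<in> out_arcs P (OutPort v i)"
    using transitionD[OF T, of ?s] by simp
  then show ?thesis using out_arcs_OutPort v by simp
qed

lemma head_segment:
  assumes "v \<in> W" "k < length (network c v)" "i \<in> network c v ! k"
  shows "segment v i k \<in> arcs P" "head P (segment v i k) = Switch v k"
proof -
  have "segment v i k \<in> in_arcs P (Switch v k)" using assms in_arcs_Switch by simp
  then show "segment v i k \<in> arcs P" "head P (segment v i k) = Switch v k" by simp_all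
qed

lemma nth_gadget_setting:
  assumes "v \<in> W" "k < length (network c v)"
  shows "gadget_setting G c T v ! k \<longleftrightarrow>
    (\<exists>i \<in> network c v ! k. wire (T (Switch v k) (segment v i k)) \<noteq> i)"
  using assms by (simp add: gadget_setting_def in_arcs_Switch del: in_in_arcs_conv)

lemma length_gadget_setting [simp]: "length (gadget_setting G c T v) = length (network c v)"
  by (simp add: gadget_setting_def)

text \<open>Two-element sets admit two bijections, straight and crossed. The crossed one changes
  both wire numbers, so the existential in \<open>gadget_setting\<close> tells them apart.\<close>

lemma T_Switch:
  assumes T: "T \<in> transition_systems P" and k: "v \<in> W" "k < length (network c v)"
    and i: "i \<in> network c v ! k"
  shows "T (Switch v k) (segment v i k) =
    Seg v (switch_perm (network c v ! k) (gadget_setting G c T v ! k) i) (Suc k)"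
proof -
  let ?p = "network c v ! k"
  let ?\<tau> = "T (Switch v k)"
  obtain x y where p: "?p = {x, y}" "x \<noteq> y"
    using nth_switch[OF k] by (auto simp: card_2_iff)
  have "?\<tau> \<in> local_transitions P (Switch v k)"
    using transitionD(1)[OF T] head_segment[OF k i] by metis
  then have "bij_betw ?\<tau> {segment v x k, segment v y k} {Seg v x (Suc k), Seg v y (Suc k)}"
    using local_transitionsD(1) by (fastforce simp: in_arcs_Switch[OF k] out_arcs_Switch[OF k] p)
  moreover have "segment v x k \<noteq> segment v y k" using p(2) by (simp add: segment_def)
  ultimately have "?\<tau> (segment v x k) = Seg v x (Suc k) \<and> ?\<tau> (segment v y k) = Seg v y (Suc k)
      \<or> ?\<tau> (segment v x k) = Seg v y (Suc k) \<and> ?\<tau> (segment v y k) = Seg v x (Suc k)"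
    using p(2) by (auto simp: bij_betw_def doubleton_eq_iff)
  moreover have "switch_perm ?p b x = (if b then y else x)" "switch_perm ?p b y = (if b then x else y)" for b
    using p by (auto simp: switch_perm_def min_def max_def)
  moreover have "gadget_setting G c T v ! k \<longleftrightarrow>
      wire (?\<tau> (segment v x k)) \<noteq> x \<or> wire (?\<tau> (segment v y k)) \<noteq> y"
    using nth_gadget_setting[OF k] p by simp
  ultimately show ?thesis using i p by auto
qed

text \<open>Inverse of reading off the settings. At an isolated vertex \<open>the_elem\<close> is
  applied to an empty set, harmlessly, because there is no incoming arc either.\<close>

definition build :: "('v \<Rightarrow> bool list) \<Rightarrow> 'v net_vert \<Rightarrow> ('v, 'e) net_arc \<Rightarrow> ('v, 'e) net_arc" where
  "build \<beta> = (\<lambda>u \<in> verts P. \<lambda>a \<in> in_arcs P u. case u of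
      Switch v k \<Rightarrow> Seg v (switch_perm (network c v ! k) (\<beta> v ! k) (wire a)) (Suc k)
    | _ \<Rightarrow> the_elem (out_arcs P u))"

lemma build_Switch:
  assumes "v \<in> W" "k < length (network c v)" "i \<in> network c v ! k"
  shows "build \<beta> (Switch v k) (segment v i k) =
    Seg v (switch_perm (network c v ! k) (\<beta> v ! k) i) (Suc k)"
  using head_segment[OF assms] assms by (simp add: build_def verts_P)

lemma bij_betw_the_elem:
  assumes "finite A" "card A \<le> 1" "card B = card A" "finite B"
  shows "bij_betw (\<lambda>_. the_elem B) A B"
proof (cases "A = {}")
  case True
  then show ?thesis using assms by (simp add: bij_betw_def)
next
  case False
  then have "card A = 1" "card B = 1" using assms by (auto simp: le_Suc_eq)
  then obtain a b where "A = {a}" "B = {b}" by (metis card_1_singletonE)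
  then show ?thesis by simp
qed

lemma build_transition_systems: "build \<beta> \<in> transition_systems P"
  unfolding transition_systems_def
proof (rule PiE_I)
  fix u assume u: "u \<in> verts P"
  show "build \<beta> u \<in> local_transitions P u"
  proof (rule local_transitionsI)
    show "build \<beta> u \<in> extensional (in_arcs P u)" using u by (simp add: build_def)
    show "bij_betw (build \<beta> u) (in_arcs P u) (out_arcs P u)"
    proof (cases "\<exists>v k. u = Switch v k")
      case True
      then obtain v k where uk: "u = Switch v k" by auto
      then have k: "v \<in> W" "k < length (network c v)" using u by (auto simp: verts_P)
      let ?p = "network c v ! k"
      have \<pi>: "switch_perm ?p (\<beta> v ! k) permutes ?p"
        using nth_switch[OF k] by (simp add: switch_perm_permutes)
      show ?thesis
        unfolding uk in_arcs_Switch[OF k] out_arcs_Switch[OF k]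
      proof (rule bij_betw_imageI)
        show "inj_on (build \<beta> (Switch v k)) ((\<lambda>i. segment v i k) ` ?p)"
          using permutes_inj[OF \<pi>] by (auto simp: inj_on_def build_Switch[OF k])
        have "(\<lambda>i. build \<beta> (Switch v k) (segment v i k)) ` ?p =
            (\<lambda>i. Seg v i (Suc k)) ` switch_perm ?p (\<beta> v ! k) ` ?p"
          unfolding image_image by (rule image_cong) (simp_all add: build_Switch[OF k])
        then show "build \<beta> (Switch v k) ` (\<lambda>i. segment v i k) ` ?p = (\<lambda>i. Seg v i (Suc k)) ` ?p"
          by (simp add: image_image[of "build \<beta> (Switch v k)"] permutes_image[OF \<pi>])
      qed
    next
      case False
      then have "build \<beta> u a = the_elem (out_arcs P u)" if "a \<in> in_arcs P u" for a
        using u that by (cases u) (auto simp: build_def)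
      then show ?thesis
        using bij_betw_the_elem[of "in_arcs P u" "out_arcs P u"] forced_vertex[OF u] False
          P.finite_in_arcs P.finite_out_arcs by (subst bij_betw_cong) auto
    qed
  qed
qed (simp add: build_def)

abbreviation "settings \<equiv> \<Pi>\<^sub>E v \<in> W. {bs :: bool list. length bs = length (network c v)}"

text \<open>Every switch has exactly two local transitions and every other vertex exactly one.
  Unconditioned transition systems therefore correspond to free, independent choices of
  settings.\<close>

lemma bij_betw_settings:
  "bij_betw (\<lambda>T. \<lambda>v \<in> W. gadget_setting G c T v) (transition_systems P) settings"
proof (rule bij_betw_byWitness[where f' = build])
  show "\<forall>T \<in> transition_systems P. build (\<lambda>v \<in> W. gadget_setting G c T v) = T"
  proof
    fix T assume T: "T \<in> transition_systems P"
    let ?B = "build (\<lambda>v \<in> W. gadget_setting G c T v)"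
    show "?B = T"
    proof (rule transition_systems_ext[OF build_transition_systems T])
      fix a assume a: "a \<in> arcs P" "head P a \<in> verts P"
      show "?B (head P a) a = T (head P a) a"
      proof (cases "\<exists>v k. head P a = Switch v k")
        case True
        then obtain v k where u: "head P a = Switch v k" by auto
        then have k: "v \<in> W" "k < length (network c v)" using a by (auto simp: verts_P)
        have "a \<in> in_arcs P (Switch v k)" using a u by simp
        then obtain i where "i \<in> network c v ! k" "a = segment v i k"
          unfolding in_arcs_Switch[OF k] by auto
        then show ?thesis using k u by (simp add: build_Switch T_Switch[OF T])
      next
        case False
        have "?B (head P a) = T (head P a)"
          using forced_vertex[OF a(2)] False transitionD(1)[OF T a(1)]
            transitionD(1)[OF build_transition_systems a(1)]
          by (intro local_transitions_unique[of P "head P a"]) (auto simp: in_degree_def)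
        then show ?thesis by simp
      qed
    qed
  qed
  show "\<forall>\<beta> \<in> settings. (\<lambda>v \<in> W. gadget_setting G c (build \<beta>) v) = \<beta>"
  proof
    fix \<beta> assume \<beta>: "\<beta> \<in> settings"
    show "(\<lambda>v \<in> W. gadget_setting G c (build \<beta>) v) = \<beta>"
    proof (rule PiE_ext[OF _ \<beta>])
      fix v assume v: "v \<in> W"
      have "gadget_setting G c (build \<beta>) v = \<beta> v"
      proof (rule nth_equalityI)
        show "length (gadget_setting G c (build \<beta>) v) = length (\<beta> v)"
          using \<beta> v by (auto dest: PiE_mem)
        fix k assume "k < length (gadget_setting G c (build \<beta>) v)"
        then have k: "k < length (network c v)" by simp
        have p: "card (network c v ! k) = 2" using nth_switch[OF v k] by simp
        \<comment> \<open>\<open>gadget_setting\<close> is existential, so a switch without wires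
          would always read as straight.\<close>
        then have "network c v ! k \<noteq> {}" by auto
        then show "gadget_setting G c (build \<beta>) v ! k = \<beta> v ! k"
          using switch_perm_moves[OF p] by (auto simp: nth_gadget_setting[OF v k] build_Switch[OF v k])
      qed
      then show "(\<lambda>v \<in> W. gadget_setting G c (build \<beta>) v) v = \<beta> v" using v by simp
    qed simp
  qed
qed (auto simp: build_transition_systems)

subsection \<open>Reading the gadgets\<close>

lemma read_gadgets_W:
  assumes "e \<in> arcs H" "head H e \<in> W"
  shows "read_gadgets G c T (head H e) e = out_ext (head H e)
    (net_perm (network c (head H e)) (gadget_setting G c T (head H e)) (in_port c e))"
  using assms W_verts by (simp add: read_gadgets_def out_ext_def)

lemma read_gadgets_Orig:
  assumes "e \<in> arcs H" "head H e \<notin> W"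
  shows "read_gadgets G c T (head H e) e = ext_arc (T (Orig (head H e)) (Ext e))"
  using assms by (simp add: read_gadgets_def)

lemma net_permutes: "v \<in> W \<Longrightarrow> net_perm (network c v) bs permutes {..<deg G c v}"
  using switches by (intro net_perm_permutes) auto

lemma T_Orig:
  assumes T: "T \<in> transition_systems P" and v: "v \<in> verts H" "v \<notin> W"
  shows "bij_betw (\<lambda>e. ext_arc (T (Orig v) (Ext e))) (in_arcs H v) (out_arcs H v)"
    and "e \<in> in_arcs H v \<Longrightarrow> T (Orig v) (Ext e) = Ext (ext_arc (T (Orig v) (Ext e)))"
proof -
  have "T (Orig v) \<in> local_transitions P (Orig v)"
    using T v by (auto simp: transition_systems_def verts_P)
  then have b: "bij_betw (T (Orig v)) (Ext ` in_arcs H v) (Ext ` out_arcs H v)"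
    using local_transitionsD(1) v by (fastforce simp: in_arcs_Orig out_arcs_Orig)
  have E: "bij_betw Ext (in_arcs H v) (Ext ` in_arcs H v)"
    by (simp add: bij_betw_def inj_on_def)
  have X: "bij_betw ext_arc (Ext ` out_arcs H v) (out_arcs H v)"
    by (simp add: bij_betw_def inj_on_def image_image)
  show "bij_betw (\<lambda>e. ext_arc (T (Orig v) (Ext e))) (in_arcs H v) (out_arcs H v)"
    using bij_betw_trans[OF bij_betw_trans[OF E b] X] by (simp add: comp_def)
  show "T (Orig v) (Ext e) = Ext (ext_arc (T (Orig v) (Ext e)))" if "e \<in> in_arcs H v"
  proof -
    have "T (Orig v) (Ext e) \<in> Ext ` out_arcs H v"
      using bij_betwE[OF b] that by blast
    then show ?thesis by auto
  qed
qed

lemma read_gadgets_transition_systems: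
  assumes T: "T \<in> transition_systems P"
  shows "read_gadgets G c T \<in> transition_systems H"
  unfolding transition_systems_def
proof (rule PiE_I)
  fix v assume v: "v \<in> verts H"
  show "read_gadgets G c T v \<in> local_transitions H v"
  proof (rule local_transitionsI)
    show "read_gadgets G c T v \<in> extensional (in_arcs H v)" using v by (simp add: read_gadgets_def)
    show "bij_betw (read_gadgets G c T v) (in_arcs H v) (out_arcs H v)"
    proof (cases "v \<in> W")
      case True
      have "bij_betw (out_ext v) {..<deg G c v} (out_arcs H v)"
        unfolding out_ext_def by (rule bij_betw_inv_into[OF out_port[OF True]])
      from bij_betw_trans[OF bij_betw_trans[OF in_port[OF True]
          permutes_imp_bij[OF net_permutes[OF True, of "gadget_setting G c T v"]]] this]
      show ?thesis
        by (rule iffD1[OF bij_betw_cong, rotated]) (use True in \<open>auto simp: read_gadgets_W\<close>)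
    next
      case False
      from T_Orig(1)[OF T v this] show ?thesis
        by (rule iffD1[OF bij_betw_cong, rotated]) (use False in \<open>auto simp: read_gadgets_Orig\<close>)
    qed
  qed
qed (simp add: read_gadgets_def)

text \<open>The local transition at \<open>v\<close> transported to wire numbers. It is the identity
  beyond the degree so as to be one of the permutations over which \<open>pointwise_bound\<close>
  quantifies.\<close>

definition port_perm :: "('v \<Rightarrow> 'e \<Rightarrow> 'e) \<Rightarrow> 'v \<Rightarrow> nat \<Rightarrow> nat" where
  "port_perm T v i = (if i < deg G c v then out_port c (T v (in_ext v i)) else i)"

lemma port_perm_permutes:
  assumes T: "T \<in> transition_systems H" and v: "v \<in> W"
  shows "port_perm T v permutes {..<deg G c v}"
proof (rule bij_imp_permutes)
  have "T v \<in> local_transitions H v"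
    using T W_verts[OF v] by (auto simp: transition_systems_def)
  moreover have "bij_betw (in_ext v) {..<deg G c v} (in_arcs H v)"
    unfolding in_ext_def by (rule bij_betw_inv_into[OF in_port[OF v]])
  ultimately have "bij_betw (out_port c \<circ> (T v \<circ> in_ext v)) {..<deg G c v} {..<deg G c v}"
    using out_port[OF v] by (intro bij_betw_trans) (auto dest: local_transitionsD)
  then show "bij_betw (port_perm T v) {..<deg G c v} {..<deg G c v}"
    by (rule iffD1[OF bij_betw_cong, rotated]) (simp add: port_perm_def)
qed (simp add: port_perm_def)

text \<open>At replaced vertices the port numberings lose nothing, and elsewhere the transition is
  forced. Equality thus splits into one condition per gadget, which is what makes fibres
  products.\<close>

lemma read_gadgets_eq_iff:
  assumes T: "T \<in> transition_systems P" and S: "S \<in> transition_systems H"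
  shows "read_gadgets G c T = S \<longleftrightarrow>
    (\<forall>v \<in> W. net_perm (network c v) (gadget_setting G c T v) = port_perm S v)"
proof
  assume eq: "read_gadgets G c T = S"
  show "\<forall>v \<in> W. net_perm (network c v) (gadget_setting G c T v) = port_perm S v"
  proof
    fix v assume v: "v \<in> W"
    let ?\<pi> = "net_perm (network c v) (gadget_setting G c T v)"
    show "?\<pi> = port_perm S v"
    proof
      fix i
      show "?\<pi> i = port_perm S v i"
      proof (cases "i < deg G c v")
        case True
        then have "?\<pi> i < deg G c v"
          using permutes_in_image[OF net_permutes[OF v]] by (metis lessThan_iff)
        then show ?thesis
          using True eq read_gadgets_W[of "in_ext v i" T] in_ext[OF v True] v
          by (auto simp: port_perm_def out_ext)
      next
        case False
        then show ?thesis
          using permutes_not_in[OF net_permutes[OF v]] by (simp add: port_perm_def)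
      qed
    qed
  qed
next
  assume eq: "\<forall>v \<in> W. net_perm (network c v) (gadget_setting G c T v) = port_perm S v"
  show "read_gadgets G c T = S"
  proof (rule transition_systems_ext[OF read_gadgets_transition_systems[OF T] S])
    fix e assume e: "e \<in> arcs H" "head H e \<in> verts H"
    have loc: "S (head H e) \<in> local_transitions H (head H e)"
      "read_gadgets G c T (head H e) \<in> local_transitions H (head H e)"
      using S read_gadgets_transition_systems[OF T] e by (auto simp: transition_systems_def)
    show "read_gadgets G c T (head H e) e = S (head H e) e"
    proof (cases "head H e \<in> W")
      case True
      then have "read_gadgets G c T (head H e) e = out_ext (head H e) (port_perm S (head H e) (in_port c e))"
        using e eq by (simp add: read_gadgets_W)
      also have "\<dots> = S (head H e) e"
        using in_port_in_ext[OF e(1) True] local_transitionsD(3)[OF loc(1) e(1)] True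
          out_port_out_ext[of "S (head H e) e"]
        by (auto simp: port_perm_def)
      finally show ?thesis .
    next
      case False
      then show ?thesis
        using local_transitions_unique[OF _ _ loc(2) loc(1)] low_degree[OF e(2)]
          H.finite_in_arcs by auto
    qed
  qed
qed

section \<open>First return to the outer arcs\<close>

lemma segment_not_Ext [simp]: "segment v i k \<notin> Ext ` A"
  by (auto simp: segment_def)

text \<open>Inside a gadget the arc permutation follows a signal from segment to segment, so its first
  return to the arcs outside the gadgets is the arc permutation of the transition system read off.\<close>

lemma first_hit_segment:
  assumes T: "T \<in> transition_systems P" and v: "v \<in> W"
    and "k \<le> length (network c v)" "i < deg G c v"
  shows "first_hit (arc_perm P T) (Ext ` arcs H) (segment v i k)
    (Ext (out_ext v (net_perm (drop k (network c v)) (drop k (gadget_setting G c T v)) i)))"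
  using assms(3,4)
\<comment> \<open>Induction from the output side: \<open>net_perm\<close> consumes its list from the
  front, so \<open>drop k\<close> keeps exactly the switches still ahead.\<close>
proof (induction k arbitrary: i rule: inc_induct)
  case base
  let ?s = "segment v i (length (network c v))"
  have "?s \<in> in_arcs P (OutPort v i)" using in_arcs_OutPort v base by simp
  then have "arc_perm P T ?s = Ext (out_ext v i)"
    using T_OutPort[OF T v base] by (simp add: arc_perm_def)
  then have "first_hit (arc_perm P T) (Ext ` arcs H) (arc_perm P T ?s) (Ext (out_ext v i))"
    using out_ext(1)[OF v base] by (simp add: first_hit.here)
  then show ?case by (simp add: first_hit.step)
next
  case (step k)
  let ?p = "network c v ! k" and ?b = "gadget_setting G c T v ! k"
  have p: "card ?p = 2" "?p \<subseteq> {..<deg G c v}" using nth_switch[OF v step.hyps(2)] by auto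
  let ?j = "switch_perm ?p ?b i"
  have drops: "drop k (network c v) = ?p # drop (Suc k) (network c v)"
    "drop k (gadget_setting G c T v) = ?b # drop (Suc k) (gadget_setting G c T v)"
    using step.hyps(2) by (simp_all add: Cons_nth_drop_Suc)
  have "?j < deg G c v"
    using permutes_in_image[OF permutes_subset[OF switch_perm_permutes[OF p(1)] p(2)]] step.prems
    by (metis lessThan_iff)
  from step.IH[OF this]
  have IH: "first_hit (arc_perm P T) (Ext ` arcs H) (segment v ?j (Suc k))
      (Ext (out_ext v (net_perm (drop k (network c v)) (drop k (gadget_setting G c T v)) i)))"
    unfolding drops net_perm_Cons comp_apply .
  show ?case
  proof (cases "i \<in> ?p")
    case True
    then have "?j \<in> ?p" using p by (simp add: switch_perm_in_iff)
    then have "segment v ?j (Suc k) = Seg v ?j (Suc k)" by (simp add: segment_def)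
    then have "arc_perm P T (segment v i k) = segment v ?j (Suc k)"
      using T_Switch[OF T v step.hyps(2) True] head_segment[OF v step.hyps(2) True]
      by (simp add: arc_perm_def)
    then show ?thesis using IH by (metis first_hit.step segment_not_Ext)
  next
    case False
    \<comment> \<open>A wire that skips switch \<open>k\<close> stays on its segment, so no step of
      the arc permutation is spent.\<close>
    then have "segment v ?j (Suc k) = segment v i k"
      using p by (simp add: switch_perm_outside segment_def)
    then show ?thesis using IH by simp
  qed
qed

text \<open>Followed backwards, a signal moves to segments of smaller number until it reaches an
  input port. No cycle can therefore be hidden inside a gadget.\<close>

lemma segment_reached:
  assumes T: "T \<in> transition_systems P" and "Seg v i t \<in> arcs P"
  shows "\<exists>e \<in> arcs H. \<exists>n. Seg v i t = (arc_perm P T ^^ n) (Ext e)"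
  using assms(2)
proof (induction t arbitrary: i rule: less_induct)
  case (less t)
  then have v: "v \<in> W" "i < deg G c v" by (auto simp: Seg_in_arcs)
  consider "t = 0" | k where "t = Suc k" "k < length (network c v)" "i \<in> network c v ! k"
    using less.prems by (auto simp: Seg_in_arcs)
  then show ?case
  proof cases
    case 1
    have "Ext (in_ext v i) \<in> in_arcs P (InPort v i)" using in_arcs_InPort v by simp
    then have "Seg v i t = (arc_perm P T ^^ 1) (Ext (in_ext v i))"
      using T_InPort[OF T v] 1 by (simp add: arc_perm_def)
    then show ?thesis using in_ext[OF v] by blast
  next
    case 2
    let ?p = "network c v ! k" and ?b = "gadget_setting G c T v ! k"
    \<comment> \<open>The wire on which the signal entered: a switch is its own inverse.\<close>
    let ?j = "switch_perm ?p ?b i"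
    have j: "?j \<in> ?p" using nth_switch[OF v(1) 2(2)] 2(3) by (simp add: switch_perm_in_iff)
    have "segment v ?j k \<in> arcs P" using head_segment[OF v(1) 2(2) j] by simp
    moreover have "segment_before (network c v) ?j k < t"
      using 2(1) segment_before_le[of "network c v" ?j k] by simp
    ultimately obtain e n where e: "e \<in> arcs H" "segment v ?j k = (arc_perm P T ^^ n) (Ext e)"
      using less.IH unfolding segment_def by blast
    have "Seg v i t = arc_perm P T (segment v ?j k)"
      using T_Switch[OF T v(1) 2(2) j] head_segment[OF v(1) 2(2) j] 2(1) by (simp add: arc_perm_def)
    also have "\<dots> = (arc_perm P T ^^ Suc n) (Ext e)" by (simp add: e)
    finally show ?thesis using e by blast
  qed
qed

lemma cyclic_on_read_gadgets:
  assumes T: "T \<in> transition_systems P"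
  shows "cyclic_on (arc_perm P T) (arcs P) \<longleftrightarrow> cyclic_on (arc_perm H (read_gadgets G c T)) (arcs H)"
proof (rule cyclic_on_first_return[where h = Ext])
  show "Ext ` arcs H \<subseteq> arcs P" by (auto simp: Ext_in_arcs)
  show "arc_perm P T a \<in> arcs P" if "a \<in> arcs P" for a
    using transitionD(2)[OF T that] that by (simp add: arc_perm_def)
  show "\<exists>e \<in> arcs H. \<exists>n. a = (arc_perm P T ^^ n) (Ext e)" if "a \<in> arcs P" for a
  proof (cases a)
    case (Ext e)
    then have "e \<in> arcs H" "a = (arc_perm P T ^^ 0) (Ext e)" using that by (auto simp: Ext_in_arcs)
    then show ?thesis by blast
  next
    case (Seg v i t)
    then show ?thesis using segment_reached[OF T] that by simp
  qed
  show "inj Ext" by (simp add: inj_def)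
  fix e assume e: "e \<in> arcs H"
  show "first_hit (arc_perm P T) (Ext ` arcs H) (arc_perm P T (Ext e))
      (Ext (arc_perm H (read_gadgets G c T) e))"
  proof (cases "head H e \<in> W")
    case True
    let ?v = "head H e" and ?i = "in_port c e"
    note i = in_port_in_ext[OF e True]
    have "arc_perm P T (Ext e) = segment ?v ?i 0"
      using T_InPort[OF T True i(2)] e True i(1)
      by (simp add: arc_perm_def Ext_in_arcs ends_P segment_def)
    moreover have "arc_perm H (read_gadgets G c T) e =
        out_ext ?v (net_perm (network c ?v) (gadget_setting G c T ?v) ?i)"
      using e True by (simp add: arc_perm_def read_gadgets_W)
    ultimately show ?thesis using first_hit_segment[OF T True _ i(2), of 0] by simp
  next
    case False
    have "read_gadgets G c T (head H e) e \<in> arcs H"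
      using read_gadgets_transition_systems[OF T] e
      by (auto simp: transition_systems_def dest!: PiE_mem local_transitionsD(3))
    moreover have "arc_perm P T (Ext e) = Ext (arc_perm H (read_gadgets G c T) e)"
      using T_Orig(2)[OF T H.head_in_verts[OF e] False, of e] e False
      by (simp add: arc_perm_def Ext_in_arcs ends_P read_gadgets_Orig)
    ultimately show ?thesis using e by (auto simp: arc_perm_def intro: first_hit.here)
  qed
qed

lemma read_gadgets_in_ET_iff:
  "T \<in> transition_systems P \<Longrightarrow> T \<in> ET P \<longleftrightarrow> read_gadgets G c T \<in> ET H"
  by (simp add: ET_def cyclic_on_read_gadgets read_gadgets_transition_systems)

lemma card_read_gadgets_fibre:
  assumes S: "S \<in> ET H"
  shows "real (card {T \<in> ET P. read_gadgets G c T = S}) =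
    (\<Prod>v \<in> W. 2 ^ length (network c v) * pmf (switching_distribution (network c v)) (port_perm S v))"
proof -
  have S': "S \<in> transition_systems H" using S by (simp add: ET_def)
  let ?g = "\<lambda>T. \<lambda>v \<in> W. gadget_setting G c T v"
  let ?F = "{T \<in> ET P. read_gadgets G c T = S}"
  let ?B = "\<lambda>v. {bs. length bs = length (network c v) \<and> net_perm (network c v) bs = port_perm S v}"
  \<comment> \<open>The one-cycle condition disappears: whatever reads as the single cycle
    \<open>S\<close> is a single cycle. Only local conditions remain.\<close>
  have F: "?F = {T \<in> transition_systems P. read_gadgets G c T = S}"
    using S read_gadgets_in_ET_iff by (auto simp: ET_def)
  have "bij_betw ?g ?F (Pi\<^sub>E W ?B)"
  proof (rule bij_betw_imageI)
    show "inj_on ?g ?F"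
      using bij_betw_imp_inj_on[OF bij_betw_settings] by (rule inj_on_subset) (auto simp: F)
    show "?g ` ?F = Pi\<^sub>E W ?B"
    proof (intro equalityI subsetI)
      fix \<beta> assume \<beta>: "\<beta> \<in> Pi\<^sub>E W ?B"
      then have "\<beta> \<in> settings" by (auto simp: PiE_iff)
      then obtain T where T: "T \<in> transition_systems P" "\<beta> = ?g T"
        using bij_betw_imp_surj_on[OF bij_betw_settings] by blast
      then have "read_gadgets G c T = S"
        using \<beta> by (subst read_gadgets_eq_iff[OF _ S']) (auto simp: PiE_iff)
      then show "\<beta> \<in> ?g ` ?F" using T by (auto simp: F)
    next
      fix \<beta> assume "\<beta> \<in> ?g ` ?F"
      then obtain T where "T \<in> transition_systems P" "read_gadgets G c T = S" "\<beta> = ?g T"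
        by (auto simp: F)
      then show "\<beta> \<in> Pi\<^sub>E W ?B"
        using read_gadgets_eq_iff[OF _ S', of T] by auto
    qed
  qed
  then have "card ?F = (\<Prod>v \<in> W. card (?B v))"
    using finite_W by (simp add: bij_betw_same_card card_PiE)
  then show ?thesis by (simp add: pmf_switching_distribution)
qed

end

section \<open>Near-uniform distributions\<close>

text \<open>Numerator and denominator each deviate by a factor within exp of plus or minus \<eta>,
  hence the doubled exponent. The scale \<open>Q\<close> cancels.\<close>

lemma ratio_bounds:
  fixes N :: "'a \<Rightarrow> real"
  assumes A: "finite A" "x \<in> A" and pos: "0 < Q"
    and N: "\<And>y. y \<in> A \<Longrightarrow> exp (- \<eta>) * Q \<le> N y \<and> N y \<le> exp \<eta> * Q"
  shows "exp (- 2 * \<eta>) / real (card A) \<le> N x / sum N A"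
    and "N x / sum N A \<le> exp (2 * \<eta>) / real (card A)"
proof -
  have card: "0 < real (card A)" using A by (auto simp: card_gt_0_iff)
  have upper: "sum N A \<le> real (card A) * (exp \<eta> * Q)"
    by (rule sum_bounded_above) (use N in auto)
  have lower: "real (card A) * (exp (- \<eta>) * Q) \<le> sum N A"
    by (rule sum_bounded_below) (use N in auto)
  have "0 < real (card A) * (exp (- \<eta>) * Q)" using card pos by simp
  then have sum_pos: "0 < sum N A" using lower by linarith
  have "0 < exp (- \<eta>) * Q" using pos by simp
  then have N_nonneg: "0 \<le> N x" using N[OF A(2)] by linarith
  have "exp (- 2 * \<eta>) / real (card A) = exp (- \<eta>) * Q / (real (card A) * (exp \<eta> * Q))"
    using pos by (simp add: exp_minus field_simps flip: exp_add)
  also have "\<dots> \<le> N x / sum N A"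
    using N[OF A(2)] N_nonneg upper sum_pos pos by (intro frac_le) auto
  finally show "exp (- 2 * \<eta>) / real (card A) \<le> N x / sum N A" .
  have "N x / sum N A \<le> exp \<eta> * Q / (real (card A) * (exp (- \<eta>) * Q))"
    using N[OF A(2)] lower card pos by (intro frac_le) auto
  also have "\<dots> = exp (2 * \<eta>) / real (card A)"
    using pos by (simp add: exp_minus field_simps flip: exp_add)
  finally show "N x / sum N A \<le> exp (2 * \<eta>) / real (card A)" .
qed

text \<open>Summing the pointwise bounds over an event of uniform probability \<open>b\<close> puts
  its probability between \<open>b * exp (- \<epsilon>)\<close> and
  \<open>b * exp \<epsilon>\<close>; the worst case is \<open>b = 1\<close>.\<close>

lemma tv_dist_near_uniform:
  assumes A: "finite A" "A \<noteq> {}" and p: "set_pmf p \<subseteq> A" and "0 \<le> \<epsilon>"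
    and lower: "\<And>x. x \<in> A \<Longrightarrow> exp (- \<epsilon>) / real (card A) \<le> pmf p x"
    and upper: "\<And>x. x \<in> A \<Longrightarrow> pmf p x \<le> exp \<epsilon> / real (card A)"
  shows "tv_dist p (pmf_of_set A) \<le> exp \<epsilon> - 1"
  unfolding tv_dist_def
proof (rule cSUP_least)
  fix B
  let ?q = "pmf_of_set A"
  define b where "b = real (card (A \<inter> B)) / real (card A)"
  have card: "0 < real (card A)" using A by (simp add: card_gt_0_iff)
  have b: "0 \<le> b" "b \<le> 1" using card A by (auto simp: b_def divide_le_eq_1 card_mono)
  have q: "measure_pmf.prob ?q B = b" using A by (simp add: b_def measure_pmf_of_set)
  have pB: "measure_pmf.prob p B = sum (pmf p) (A \<inter> B)"
  proof -
    have "measure_pmf.prob p B = measure_pmf.prob p (B \<inter> set_pmf p)"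
      by (simp add: measure_Int_set_pmf)
    also have "B \<inter> set_pmf p = A \<inter> B \<inter> set_pmf p" using p by auto
    also have "measure_pmf.prob p \<dots> = measure_pmf.prob p (A \<inter> B)"
      by (simp add: measure_Int_set_pmf)
    finally show ?thesis using A by (simp add: measure_measure_pmf_finite)
  qed
  have "sum (pmf p) (A \<inter> B) \<le> real (card (A \<inter> B)) * (exp \<epsilon> / real (card A))"
    by (rule sum_bounded_above) (use upper in auto)
  then have up: "measure_pmf.prob p B \<le> b * exp \<epsilon>" by (simp add: pB b_def)
  have "real (card (A \<inter> B)) * (exp (- \<epsilon>) / real (card A)) \<le> sum (pmf p) (A \<inter> B)"
    by (rule sum_bounded_below) (use lower in auto)
  then have low: "b * exp (- \<epsilon>) \<le> measure_pmf.prob p B" by (simp add: pB b_def)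
  have "b * (exp \<epsilon> - 1) \<le> 1 * (exp \<epsilon> - 1)"
    using b \<open>0 \<le> \<epsilon>\<close> by (intro mult_right_mono) auto
  moreover have "b * (1 - exp (- \<epsilon>)) \<le> 1 * (1 - exp (- \<epsilon>))"
    using b \<open>0 \<le> \<epsilon>\<close> by (intro mult_right_mono) auto
  \<comment> \<open>The downward deviation is dominated by the upward one, because
    \<open>exp \<epsilon> + exp (- \<epsilon>)\<close> is at least 2.\<close>
  moreover have "1 - exp (- \<epsilon>) \<le> exp \<epsilon> - 1"
    using exp_ge_add_one_self[of \<epsilon>] exp_ge_add_one_self[of "- \<epsilon>"] by linarith
  ultimately show "\<bar>measure_pmf.prob p B - measure_pmf.prob ?q B\<bar> \<le> exp \<epsilon> - 1"
    unfolding q using up low by (simp add: abs_le_iff algebra_simps)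
qed simp

section \<open>The law of the projection\<close>

text \<open>\<open>Q\<close> is the fibre size that exactly uniform gadgets would give, the same for
  all \<open>S\<close>. The errors of the single gadgets add up in the exponent.\<close>

lemma (in gadget_insertion) card_fibre_bounds:
  assumes S: "S \<in> ET H"
    and bound: "\<And>v. v \<in> W \<Longrightarrow> pointwise_bound (deg G c v) (network c v) (gadget_error c v)"
  defines "Q \<equiv> \<Prod>v \<in> W. 2 ^ length (network c v) / (fact (deg G c v) :: real)"
    and "\<eta> \<equiv> \<Sum>v \<in> W. gadget_error c v"
  shows "exp (- \<eta>) * Q \<le> real (card {T \<in> ET P. read_gadgets G c T = S})"
    and "real (card {T \<in> ET P. read_gadgets G c T = S}) \<le> exp \<eta> * Q"
proof -
  let ?\<mu> = "\<lambda>v. pmf (switching_distribution (network c v)) (port_perm S v)"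
  have \<mu>: "exp (- gadget_error c v) / fact (deg G c v) \<le> ?\<mu> v"
    "?\<mu> v \<le> exp (gadget_error c v) / fact (deg G c v)" if "v \<in> W" for v
    using bound[OF that] port_perm_permutes[of S v] S that
    by (auto simp: pointwise_bound_def ET_def)
  have "exp (- \<eta>) * Q =
      (\<Prod>v \<in> W. 2 ^ length (network c v) * (exp (- gadget_error c v) / fact (deg G c v)))"
    using finite_W by (simp add: Q_def \<eta>_def exp_sum prod.distrib mult_ac flip: sum_negf prod.distrib)
  also have "\<dots> \<le> (\<Prod>v \<in> W. 2 ^ length (network c v) * ?\<mu> v)"
    using \<mu> by (intro prod_mono conjI mult_left_mono) auto
  finally show "exp (- \<eta>) * Q \<le> real (card {T \<in> ET P. read_gadgets G c T = S})"
    by (simp add: card_read_gadgets_fibre[OF S])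
  have "(\<Prod>v \<in> W. 2 ^ length (network c v) * ?\<mu> v) \<le>
      (\<Prod>v \<in> W. 2 ^ length (network c v) * (exp (gadget_error c v) / fact (deg G c v)))"
    using \<mu> by (intro prod_mono conjI mult_left_mono) auto
  also have "\<dots> = exp \<eta> * Q"
    using finite_W by (simp add: Q_def \<eta>_def exp_sum mult_ac flip: prod.distrib)
  finally show "real (card {T \<in> ET P. read_gadgets G c T = S}) \<le> exp \<eta> * Q"
    by (simp add: card_read_gadgets_fibre[OF S])
qed

lemma (in gadget_insertion) pmf_read_gadgets_bounds:
  assumes S: "S \<in> ET H" and nonempty: "ET P \<noteq> {}"
    and bound: "\<And>v. v \<in> W \<Longrightarrow> pointwise_bound (deg G c v) (network c v) (gadget_error c v)"
  defines "\<eta> \<equiv> \<Sum>v \<in> W. gadget_error c v"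
    and "p \<equiv> pmf (map_pmf (read_gadgets G c) (pmf_of_set (ET P))) S"
  shows "exp (- 2 * \<eta>) / real (card (ET H)) \<le> p" and "p \<le> exp (2 * \<eta>) / real (card (ET H))"
proof -
  let ?N = "\<lambda>S. real (card {T \<in> ET P. read_gadgets G c T = S})"
  let ?Q = "\<Prod>v \<in> W. 2 ^ length (network c v) / (fact (deg G c v) :: real)"
  have fin_H: "finite (ET H)" and fin_P: "finite (ET P)"
    by (rule finite_ET, unfold_locales)+
  have "read_gadgets G c ` ET P \<subseteq> ET H"
    using read_gadgets_in_ET_iff by (auto simp: ET_def)
  \<comment> \<open>The fibres partition \<open>ET P\<close>, so the normalizing constant is the sum
    of the quantities just bounded.\<close>
  then have "card (ET P) = (\<Sum>S \<in> ET H. card {T \<in> ET P. read_gadgets G c T = S})"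
    using fin_H fin_P by (subst card_eq_sum) (subst sum.group[symmetric, where g = "read_gadgets G c"], auto)
  then have total: "real (card (ET P)) = sum ?N (ET H)" by simp
  have "ET P \<inter> read_gadgets G c -` {S} = {T \<in> ET P. read_gadgets G c T = S}" by auto
  then have p: "p = ?N S / sum ?N (ET H)"
    using nonempty fin_P by (simp add: p_def pmf_map measure_pmf_of_set flip: total)
  have Q: "0 < ?Q" by (intro prod_pos) simp
  note bounds = card_fibre_bounds[OF _ bound]
  show "exp (- 2 * \<eta>) / real (card (ET H)) \<le> p"
    unfolding p \<eta>_def by (rule ratio_bounds(1)[OF fin_H S Q]) (use bounds in blast)
  show "p \<le> exp (2 * \<eta>) / real (card (ET H))"
    unfolding p \<eta>_def by (rule ratio_bounds(2)[OF fin_H S Q]) (use bounds in blast)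
qed

section \<open>Valid constructions as gadget insertions\<close>

lemma valid_suppressions:
  assumes "valid_construction C G c"
  shows "suppression_sequence G (removal_order c)"
    and "suppression_sequence (port_graph G c) (port_order c)"
  using assms by (auto simp: valid_construction_def split: if_splits)

lemma reduced_facts:
  assumes "eulerian_digraph G" "valid_construction C G c"
  shows "fin_digraph (reduced G c)" "arcs (reduced G c) \<subseteq> arcs G"
    and "v \<in> verts (reduced G c) \<Longrightarrow> in_degree (reduced G c) v = out_degree (reduced G c) v"
proof -
  have G: "fin_digraph G" using assms(1) by (simp add: eulerian_digraph_def)
  note facts = suppress_all_facts[OF G valid_suppressions(1)[OF assms(2)], folded reduced_def]
  show "fin_digraph (reduced G c)" "arcs (reduced G c) \<subseteq> arcs G" using facts by auto
  show "v \<in> verts (reduced G c) \<Longrightarrow> in_degree (reduced G c) v = out_degree (reduced G c) v"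
    using facts assms(1) by (simp add: eulerian_digraph_def)
qed

lemma set_random_network:
  assumes "ps \<in> set_pmf (random_network C D \<eta> \<delta>)" "2 \<le> D"
  shows "length ps = D - 1 + num_random_switches C D \<eta> \<delta>"
    and "p \<in> set ps \<Longrightarrow> p \<subseteq> {..<D} \<and> card p = 2"
proof -
  let ?A = "{p. p \<subseteq> {..<D} \<and> card p = 2}"
  have "finite ?A" by (rule finite_subset[of _ "Pow {..<D}"]) auto
  \<comment> \<open>Degree at least two makes the set of wire pairs nonempty, without which
    \<open>pmf_of_set\<close> would not have it as support.\<close>
  moreover have "{0, 1} \<in> ?A" using assms(2) by auto
  then have "?A \<noteq> {}" by blast
  ultimately have "set_pmf (pmf_of_set ?A) = ?A" by (intro set_pmf_of_set)
  then obtain qs where qs: "ps = adjacent_switches D @ qs" "set qs \<subseteq> ?A"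
    "length qs = num_random_switches C D \<eta> \<delta>"
    using assms(1) by (auto simp: random_network_def set_replicate_pmf)
  show "length ps = D - 1 + num_random_switches C D \<eta> \<delta>"
    by (simp add: qs adjacent_switches_def)
  show "p \<in> set ps \<Longrightarrow> p \<subseteq> {..<D} \<and> card p = 2"
    using qs(1,2) assms(2) by (auto simp: adjacent_switches_def)
qed

lemma valid_gadget_insertion:
  assumes "eulerian_digraph G" "valid_construction C G c"
  shows "gadget_insertion G c"
proof (rule gadget_insertion.intro)
  fix v p assume "v \<in> V_ge2 G c" "p \<in> set (network c v)"
  then show "p \<subseteq> {..<deg G c v} \<and> card p = 2"
    using assms(2) set_random_network(2)[of "network c v" C "deg G c v"]
    by (auto simp: valid_construction_def V_ge2_def)
qed (use assms reduced_facts[OF assms] in \<open>auto simp: valid_construction_def\<close>)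

lemma projection_law_bounds:
  assumes G: "eulerian_digraph G" and c: "valid_construction C G c"
    and bound: "\<forall>v \<in> V_ge2 G c. pointwise_bound (deg G c v) (network c v) (gadget_error c v)"
    and nonempty: "ET (Gstar G c) \<noteq> {}"
  defines "\<eta> \<equiv> \<Sum>v \<in> V_ge2 G c. gadget_error c v"
    and "law \<equiv> map_pmf (projection G c) (pmf_of_set (ET (Gstar G c)))"
  shows "T0 \<in> ET G \<Longrightarrow> exp (- 2 * \<eta>) / real (card (ET G)) \<le> pmf law T0"
    and "T0 \<in> ET G \<Longrightarrow> pmf law T0 \<le> exp (2 * \<eta>) / real (card (ET G))"
    and "tv_dist law (pmf_of_set (ET G)) \<le> exp (2 * \<eta>) - 1"
proof -
  interpret gadget_insertion G c by (rule valid_gadget_insertion[OF G c])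
  let ?U = "unsuppress_all G (removal_order c)"
  let ?UP = "unsuppress_all P (port_order c)"
  let ?law = "map_pmf (read_gadgets G c) (pmf_of_set (ET P))"
  have finG: "fin_digraph G" using G by (simp add: eulerian_digraph_def)
  have U: "bij_betw ?U (ET H) (ET G)"
    unfolding reduced_def by (rule bij_betw_unsuppress_all[OF finG valid_suppressions(1)[OF c]])
  have UP: "bij_betw ?UP (ET (Gstar G c)) (ET P)"
    unfolding Gstar_def by (rule bij_betw_unsuppress_all[OF fin_digraph_P valid_suppressions(2)[OF c]])
  have card: "card (ET H) = card (ET G)" using U by (rule bij_betw_same_card)
  have "finite (ET P)" by (rule finite_ET[OF fin_digraph_P])
  then have fin_star: "finite (ET (Gstar G c))" using UP bij_betw_finite by blast
  have ne: "ET P \<noteq> {}" using UP nonempty by (auto simp: bij_betw_def)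
  \<comment> \<open>Undoing the port suppressions is a bijection and carries the uniform law to the
    uniform law on \<open>ET P\<close>.\<close>
  have law: "law = map_pmf ?U ?law"
  proof -
    have "law = map_pmf ?U (map_pmf (read_gadgets G c) (map_pmf ?UP (pmf_of_set (ET (Gstar G c)))))"
      by (simp add: law_def pmf.map_comp comp_def projection_def[abs_def])
    then show ?thesis using map_pmf_of_set_bij_betw[OF UP nonempty fin_star] by simp
  qed
  have supp: "set_pmf ?law \<subseteq> ET H"
    using read_gadgets_in_ET_iff set_pmf_of_set[OF ne \<open>finite (ET P)\<close>] by (auto simp: ET_def)
  have inj: "inj_on ?U (set_pmf ?law)"
    using bij_betw_imp_inj_on[OF U] supp by (rule inj_on_subset)
  have finH: "finite (ET H)" by (rule finite_ET[OF fin])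
  have pmf: "exp (- 2 * \<eta>) / real (card (ET G)) \<le> pmf law T0 \<and>
      pmf law T0 \<le> exp (2 * \<eta>) / real (card (ET G))" if "T0 \<in> ET G" for T0
  proof -
    have "T0 \<in> ?U ` ET H" using that bij_betw_imp_surj_on[OF U] by simp
    then obtain S where S: "S \<in> ET H" "T0 = ?U S" by blast
    have bounds: "exp (- 2 * \<eta>) / real (card (ET G)) \<le> pmf ?law S"
      "pmf ?law S \<le> exp (2 * \<eta>) / real (card (ET G))"
      unfolding \<eta>_def card[symmetric]
      using pmf_read_gadgets_bounds[OF S(1) ne] bound by auto
    \<comment> \<open>The lower bound is positive, so \<open>S\<close> lies in the support; there
      \<open>?U\<close> is injective and preserves point masses.\<close>
    have "0 < card (ET G)" using S finH by (auto simp: card_gt_0_iff simp flip: card)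
    then have "0 < exp (- 2 * \<eta>) / real (card (ET G))" by simp
    then have "pmf ?law S \<noteq> 0" using bounds(1) by linarith
    then have "S \<in> set_pmf ?law" by (rule set_pmf_iff[THEN iffD2])
    then have "pmf law T0 = pmf ?law S"
      unfolding law S(2) by (intro pmf_map_inj inj)
    then show ?thesis using bounds by simp
  qed
  then show "T0 \<in> ET G \<Longrightarrow> exp (- 2 * \<eta>) / real (card (ET G)) \<le> pmf law T0"
    "T0 \<in> ET G \<Longrightarrow> pmf law T0 \<le> exp (2 * \<eta>) / real (card (ET G))" by auto
  have "set_pmf law \<subseteq> ET G" using supp U by (auto simp: law bij_betw_def)
  moreover have "0 \<le> \<eta>"
    unfolding \<eta>_def using c by (intro sum_nonneg) (auto simp: valid_construction_def less_imp_le)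
  moreover have "ET G \<noteq> {}"
    using calculation(1) set_pmf_not_empty[of law] by blast
  ultimately show "tv_dist law (pmf_of_set (ET G)) \<le> exp (2 * \<eta>) - 1"
    using pmf finite_ET[OF finG] by (intro tv_dist_near_uniform) auto
qed

section \<open>Size\<close>

lemma (in gadget_insertion) sum_deg_le: "(\<Sum>v \<in> W. deg G c v) \<le> card (arcs H)"
proof -
  have "(\<Sum>v \<in> W. deg G c v) = card (\<Union>v \<in> W. in_arcs H v)"
    unfolding in_degree_def using finite_W by (intro card_UN_disjoint[symmetric]) auto
  also have "\<dots> \<le> card (arcs H)" by (intro card_mono) auto
  finally show ?thesis .
qed

text \<open>A segment is named by where it starts: each input port starts one, each switch
  two.\<close>

lemma (in gadget_insertion) card_arcs_P_le:
  "card (arcs P) \<le> card (arcs H) + (\<Sum>v \<in> W. deg G c v) + (\<Sum>v \<in> W. 2 * length (network c v))"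
proof -
  let ?E = "Ext :: 'e \<Rightarrow> ('v, 'e) net_arc"
  let ?A = "\<Union>v \<in> W. (\<lambda>i. Seg v i 0 :: ('v, 'e) net_arc) ` {..<deg G c v}"
  let ?B = "\<lambda>v. \<Union>k \<in> {..<length (network c v)}. (\<lambda>i. Seg v i (Suc k) :: ('v, 'e) net_arc) ` (network c v ! k)"
  have fin_switch: "finite (network c v ! k)" if "v \<in> W" "k < length (network c v)" for v k
    using nth_switch[OF that] finite_subset by blast
  have A: "finite ?A" "card ?A \<le> (\<Sum>v \<in> W. deg G c v)"
  proof -
    have "card ?A \<le> (\<Sum>v \<in> W. card ((\<lambda>i. Seg v i 0 :: ('v, 'e) net_arc) ` {..<deg G c v}))"
      by (rule card_UN_le[OF finite_W])
    also have "\<dots> \<le> (\<Sum>v \<in> W. deg G c v)"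
      by (intro sum_mono) (metis card_image_le card_lessThan finite_lessThan)
    finally show "card ?A \<le> (\<Sum>v \<in> W. deg G c v)" .
  qed (use finite_W in auto)
  have "card (?B v) \<le> 2 * length (network c v)" if "v \<in> W" for v
  proof -
    have "card (?B v) \<le> (\<Sum>k < length (network c v). card ((\<lambda>i. Seg v i (Suc k) :: ('v, 'e) net_arc) ` (network c v ! k)))"
      by (rule card_UN_le) simp
    also have "\<dots> \<le> (\<Sum>k < length (network c v). 2)"
      using fin_switch[OF that] nth_switch[OF that] by (intro sum_mono) (metis card_image_le lessThan_iff)
    finally show ?thesis by simp
  qed
  then have "(\<Sum>v \<in> W. card (?B v)) \<le> (\<Sum>v \<in> W. 2 * length (network c v))" by (rule sum_mono)
  then have B: "card (\<Union>v \<in> W. ?B v) \<le> (\<Sum>v \<in> W. 2 * length (network c v))"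
    using card_UN_le[OF finite_W, of ?B] by linarith
  have "arcs P \<subseteq> Ext ` arcs H \<union> ?A \<union> (\<Union>v \<in> W. ?B v)"
  proof
    fix a assume "a \<in> arcs P"
    then show "a \<in> Ext ` arcs H \<union> ?A \<union> (\<Union>v \<in> W. ?B v)" by (cases rule: arcs_P_cases) blast+
  qed
  moreover have "finite (Ext ` arcs H \<union> ?A \<union> (\<Union>v \<in> W. ?B v))"
    using A(1) finite_W fin_switch by simp
  ultimately have "card (arcs P) \<le> card (Ext ` arcs H \<union> ?A \<union> (\<Union>v \<in> W. ?B v))"
    by (intro card_mono)
  also have "\<dots> \<le> card (?E ` arcs H) + card ?A + card (\<Union>v \<in> W. ?B v)"
    using card_Un_le[of "?E ` arcs H" ?A] card_Un_le[of "?E ` arcs H \<union> ?A" "\<Union>v \<in> W. ?B v"]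
    by linarith
  also have "card (?E ` arcs H) = card (arcs H)" by (simp add: card_image inj_on_def)
  finally show ?thesis using A(2) B by linarith
qed

text \<open>The two logarithms merge into that of \<open>D / (\<eta> * \<delta>)\<close>. The
  summand 1 pays for the ceiling; the 2 keeps the logarithm nonnegative, so that truncation by
  \<open>nat\<close> is also covered.\<close>

lemma num_random_switches_le:
  assumes "0 < C" "0 < D" "0 < \<eta> * \<delta>" "real D / (\<eta> * \<delta>) \<le> x"
  shows "real (num_random_switches C D \<eta> \<delta>) \<le> 2 * (C * real D * ln (2 + x) + 1)"
proof -
  have x: "0 < real D / (\<eta> * \<delta>)" using assms(2,3) by simp
  have "ln (real D) + ln (1 / (\<eta> * \<delta>)) = ln (real D / (\<eta> * \<delta>))"
    using assms(2,3) by (subst ln_mult_pos[symmetric]) auto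
  also have "\<dots> \<le> ln (2 + x)" using x assms(4) by (intro ln_mono) auto
  finally have "C * real D * (ln (real D) + ln (1 / (\<eta> * \<delta>))) \<le> C * real D * ln (2 + x)"
    using assms(1) by (intro mult_left_mono) auto
  moreover have "0 \<le> ln (2 + x)" using x assms(4) by (intro ln_ge_zero) linarith
  then have "0 \<le> C * real D * ln (2 + x)" using assms(1) by simp
  ultimately have "real (nat \<lceil>C * real D * (ln (real D) + ln (1 / (\<eta> * \<delta>)))\<rceil>) \<le> C * real D * ln (2 + x) + 1"
    by linarith
  then show ?thesis by (simp add: num_random_switches_def)
qed

text \<open>Merged arcs keep an old name, so suppressing ports only removes arcs and
  \<open>P\<close> can be counted instead. In the constant, 8 is 2 for outer arcs and port segments
  plus twice 3 for switches outside the logarithmic term; \<open>4 * C\<close> is twice the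
  \<open>2 * C\<close> of the random switches.\<close>

lemma card_arcs_Gstar_le:
  assumes C: "0 < C" and G: "eulerian_digraph G" and c: "valid_construction C G c"
    and ne: "V_ge2 G c \<noteq> {}"
  defines "\<eta>min \<equiv> Min (gadget_error c ` V_ge2 G c)"
    and "\<delta>min \<equiv> Min (failure_param c ` V_ge2 G c)"
    and "m \<equiv> real (card (arcs G))"
  shows "real (card (arcs (Gstar G c))) \<le> (8 / ln 2 + 4 * C) * m * ln (2 + m / (\<eta>min * \<delta>min))"
proof -
  interpret gadget_insertion G c by (rule valid_gadget_insertion[OF G c])
  let ?x = "m / (\<eta>min * \<delta>min)"
  let ?L = "ln (2 + ?x)"
  have pos: "0 < gadget_error c v" "0 < failure_param c v" if "v \<in> W" for v
    using c that by (auto simp: valid_construction_def)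
  have min: "0 < \<eta>min" "0 < \<delta>min"
    using finite_W ne pos by (auto simp: \<eta>min_def \<delta>min_def)
  have x: "0 \<le> ?x" using min by (simp add: m_def)
  have arcs: "real (card (arcs H)) \<le> m"
    using G reduced_facts(2)[OF G c] unfolding m_def
    by (auto intro!: card_mono simp: eulerian_digraph_def fin_digraph.finite_arcs)
  have sum_deg: "(\<Sum>v \<in> W. real (deg G c v)) \<le> m"
    using sum_deg_le arcs by (simp flip: of_nat_sum)
  have len: "real (length (network c v)) \<le> real (deg G c v) * (3 + 2 * C * ?L)" if v: "v \<in> W" for v
  proof -
    let ?D = "deg G c v"
    have D: "2 \<le> ?D" using v by (simp add: V_ge2_def)
    have "real ?D \<le> m"
      using sum_deg member_le_sum[OF v, of "\<lambda>v. real (deg G c v)"] finite_W by simp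
    moreover have "\<eta>min * \<delta>min \<le> gadget_error c v * failure_param c v"
      using finite_W v pos[OF v] min by (intro mult_mono) (auto simp: \<eta>min_def \<delta>min_def)
    ultimately have "real ?D / (gadget_error c v * failure_param c v) \<le> ?x"
      using min by (intro frac_le) (auto simp: m_def)
    then have num: "real (num_random_switches C ?D (gadget_error c v) (failure_param c v)) \<le>
        2 * (C * real ?D * ?L + 1)"
      using C D pos[OF v] by (intro num_random_switches_le) auto
    have "network c v \<in> set_pmf (random_network C ?D (gadget_error c v) (failure_param c v))"
      using c v by (auto simp: valid_construction_def)
    from set_random_network(1)[OF this D] num D
    have "real (length (network c v)) \<le> real ?D + 2 * (C * real ?D * ?L + 1) - 1"
      by simp
    \<comment> \<open>Adjacent switches and rounding contribute \<open>D - 1 + 2\<close>, which is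
      at most \<open>3 * D\<close>.\<close>
    also have "\<dots> \<le> real ?D * (3 + 2 * C * ?L)" using D by (simp add: algebra_simps)
    finally show ?thesis .
  qed
  have L: "ln 2 \<le> ?L" using x by simp
  have L0: "0 \<le> 3 + 2 * C * ?L" using C x by simp
  have "real (card (arcs (Gstar G c))) \<le> real (card (arcs P))"
    unfolding Gstar_def
    using arcs_suppress_all[OF fin_digraph_P valid_suppressions(2)[OF c]] by (simp add: card_mono)
  also have "\<dots> \<le> real (card (arcs H) + (\<Sum>v \<in> W. deg G c v) + (\<Sum>v \<in> W. 2 * length (network c v)))"
    using card_arcs_P_le by (intro of_nat_mono)
  also have "\<dots> = real (card (arcs H)) + (\<Sum>v \<in> W. real (deg G c v)) +
      2 * (\<Sum>v \<in> W. real (length (network c v)))"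
    by (simp add: sum_distrib_left)
  also have "\<dots> \<le> m + m + 2 * (m * (3 + 2 * C * ?L))"
  proof (intro add_mono mult_left_mono arcs sum_deg)
    have "(\<Sum>v \<in> W. real (length (network c v))) \<le> (\<Sum>v \<in> W. real (deg G c v)) * (3 + 2 * C * ?L)"
      unfolding sum_distrib_right by (rule sum_mono[OF len])
    also have "\<dots> \<le> m * (3 + 2 * C * ?L)" using sum_deg L0 by (rule mult_right_mono)
    finally show "(\<Sum>v \<in> W. real (length (network c v))) \<le> m * (3 + 2 * C * ?L)" .
  qed simp
  also have "\<dots> = m * (8 * 1 + 4 * C * ?L)" by (simp add: algebra_simps)
  \<comment> \<open>The logarithm is at least \<open>ln 2\<close>, so the constant term is absorbed
    into it.\<close>
  also have "\<dots> \<le> m * (8 * (?L / ln 2) + 4 * C * ?L)"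
    using L C by (intro mult_left_mono add_mono) (auto simp: m_def)
  also have "\<dots> = (8 / ln 2 + 4 * C) * m * ?L" by (simp add: algebra_simps)
  finally show ?thesis .
qed

section \<open>Graphs without gadgets\<close>

text \<open>If suppressions took place, some vertex is not of degree one. It survives with its
  degree, which must be zero as no gadget exists; strong connectivity then makes it the only vertex,
  and nothing could have been suppressed.\<close>

lemma no_gadgets_removal_order:
  assumes G: "eulerian_digraph G" and conn: "strongly_connected G" and c: "valid_construction C G c"
    and W: "V_ge2 G c = {}"
  shows "removal_order c = []"
proof (rule ccontr)
  assume ne: "removal_order c \<noteq> []"
  interpret fin_digraph G using G by (simp add: eulerian_digraph_def)
  have "\<not> (\<forall>v \<in> verts G. degree_one G v)" using ne c by (auto simp: valid_construction_def split: if_splits)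
  then obtain v where v: "v \<in> verts G" "\<not> degree_one G v" by auto
  note facts = suppress_all_facts[OF fin_digraph_axioms valid_suppressions(1)[OF c], folded reduced_def]
  have "v \<notin> set (removal_order c)" using facts v by auto
  then have "in_degree G v < 2" using facts v W by (auto simp: V_ge2_def)
  then have "out_degree G v = 0"
    using v G by (auto simp: eulerian_digraph_def degree_one_def)
  then have no_out: "out_arcs G v = {}" by (simp add: out_degree_def finite_out_arcs)
  have only: "w = v" if w: "w \<in> verts G" for w
  proof -
    have "v \<rightarrow>\<^sup>*\<^bsub>G\<^esub> w" using conn v w by (simp add: strongly_connected_def)
    then show ?thesis
    proof (cases rule: converse_reachable_cases)
      case (step u)
      then obtain a where "a \<in> out_arcs G v" by (auto simp: arcs_ends_def arc_to_ends_def)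
      then show ?thesis using no_out by auto
    qed auto
  qed
  obtain w ws where "removal_order c = w # ws" using ne by (cases "removal_order c") auto
  then have "suppressible G w" using valid_suppressions(1)[OF c] by simp
  then have "w \<in> verts G" "degree_one G w" by (simp_all add: suppressible_def)
  then show False using only[of w] v(2) by simp
qed

text \<open>Without gadgets there are no ports to suppress, and the construction merely renames
  vertices by \<open>Orig\<close> and arcs by \<open>Ext\<close>.\<close>

lemma no_gadgets:
  assumes G: "eulerian_digraph G" and conn: "strongly_connected G" and c: "valid_construction C G c"
    and W: "V_ge2 G c = {}"
  shows "v \<in> verts G \<Longrightarrow> \<exists>!\<tau>. \<tau> \<in> local_transitions G v" and "digraph_iso G (Gstar G c)"
proof -
  interpret fin_digraph G using G by (simp add: eulerian_digraph_def)
  have H: "reduced G c = G" using no_gadgets_removal_order[OF assms] by (simp add: reduced_def)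
  show "\<exists>!\<tau>. \<tau> \<in> local_transitions G v" if v: "v \<in> verts G"
  proof -
    have deg: "in_degree G v \<le> 1" "out_degree G v = in_degree G v"
      using v W G by (auto simp: V_ge2_def H eulerian_digraph_def)
    then obtain \<tau> where "bij_betw \<tau> (in_arcs G v) (out_arcs G v)"
      using finite_same_card_bij[of "in_arcs G v" "out_arcs G v"]
      by (auto simp: in_degree_def out_degree_def finite_in_arcs finite_out_arcs)
    then have "restrict \<tau> (in_arcs G v) \<in> local_transitions G v"
      by (intro local_transitionsI) (simp_all only: bij_betw_restrict_eq restrict_extensional)
    then show ?thesis using local_transitions_unique[OF finite_in_arcs deg(1)] by blast
  qed
  have "port_order c = []" using c W by (auto simp: valid_construction_def ports_def)
  then have star: "Gstar G c = port_graph G c" by (simp add: Gstar_def)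
  let ?h = "\<lparr>iso_verts = Orig, iso_arcs = Ext, iso_head = head (port_graph G c),
    iso_tail = tail (port_graph G c)\<rparr>"
  have "pre_digraph.digraph_isomorphism G ?h"
    unfolding pre_digraph.digraph_isomorphism_def
    by (auto simp: inj_on_def port_graph_def H W intro: wf_digraph_axioms)
  moreover have "port_graph G c = app_iso ?h G"
    by (simp add: app_iso_def port_graph_def H W ports_def)
  ultimately show "digraph_iso G (Gstar G c)" by (auto simp: digraph_iso_def star)
qed

text \<open>\<open>K\<close> and \<open>p\<close> precede \<open>G\<close> and \<open>c\<close>, so
  they depend on \<open>C\<close> alone; a single power of the logarithm suffices as witness. The
  data \<open>c\<close> range over all outcomes of the random construction whose gadgets satisfy the
  pointwise bound, so the remaining randomness is that of the uniform one-cycle transition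
  system.\<close>

theorem theorem6p5:
  fixes C :: real
  assumes "C > 0"
  shows "\<exists>(K :: real) (p :: nat). \<forall>(G :: ('v, 'e) pre_digraph) (c :: ('v, 'e) construction).
    eulerian_digraph G \<and> strongly_connected G \<and> valid_construction C G c \<and>
    (\<forall>v \<in> V_ge2 G c. pointwise_bound (deg G c v) (network c v) (gadget_error c v)) \<longrightarrow>
    (let \<eta>tot = (\<Sum>v \<in> V_ge2 G c. gadget_error c v);
         \<eta>min = Min (gadget_error c ` V_ge2 G c);
         \<delta>min = Min (failure_param c ` V_ge2 G c);
         m = real (card (arcs G));
         law_T = map_pmf (projection G c) (pmf_of_set (ET (Gstar G c)))
     in (ET (Gstar G c) \<noteq> {} \<longrightarrow>
           (\<forall>T0 \<in> ET G.
              exp (- 2 * \<eta>tot) / real (card (ET G)) \<le> pmf law_T T0 \<and>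
              pmf law_T T0 \<le> exp (2 * \<eta>tot) / real (card (ET G))) \<and>
           tv_dist law_T (pmf_of_set (ET G)) \<le> exp (2 * \<eta>tot) - 1) \<and>
        (V_ge2 G c \<noteq> {} \<longrightarrow>
           real (card (arcs (Gstar G c))) \<le> K * m * ln (2 + m / (\<eta>min * \<delta>min)) ^ p) \<and>
        (V_ge2 G c = {} \<longrightarrow>
           (\<forall>v \<in> verts G. \<exists>!\<tau>. \<tau> \<in> local_transitions G v) \<and>
           digraph_iso G (Gstar G c)))"
  unfolding Let_def
proof (intro exI[of _ "8 / ln 2 + 4 * C"] exI[of _ "1 :: nat"] allI impI, elim conjE, intro conjI impI ballI)
  fix G :: "('v, 'e) pre_digraph" and c :: "('v, 'e) construction"
  assume G: "eulerian_digraph G" and conn: "strongly_connected G" and c: "valid_construction C G c"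
    and bound: "\<forall>v \<in> V_ge2 G c. pointwise_bound (deg G c v) (network c v) (gadget_error c v)"
  let ?law = "map_pmf (projection G c) (pmf_of_set (ET (Gstar G c)))"
  let ?\<eta> = "\<Sum>v \<in> V_ge2 G c. gadget_error c v"
  {
    assume "ET (Gstar G c) \<noteq> {}"
    note law = projection_law_bounds[OF G c bound this]
    show "exp (- 2 * ?\<eta>) / real (card (ET G)) \<le> pmf ?law T0"
      "pmf ?law T0 \<le> exp (2 * ?\<eta>) / real (card (ET G))" if "T0 \<in> ET G" for T0
      using law(1,2)[OF that] .
    show "tv_dist ?law (pmf_of_set (ET G)) \<le> exp (2 * ?\<eta>) - 1" by (rule law(3))
  }
  show "real (card (arcs (Gstar G c))) \<le> (8 / ln 2 + 4 * C) * real (card (arcs G)) *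
      ln (2 + real (card (arcs G)) /
        (Min (gadget_error c ` V_ge2 G c) * Min (failure_param c ` V_ge2 G c))) ^ 1"
    if "V_ge2 G c \<noteq> {}"
    unfolding power_one_right by (rule card_arcs_Gstar_le[OF assms G c that])
  assume W: "V_ge2 G c = {}"
  show "\<exists>!\<tau>. \<tau> \<in> local_transitions G v" if "v \<in> verts G" for v
    using no_gadgets(1)[OF G conn c W that] .
  show "digraph_iso G (Gstar G c)" by (rule no_gadgets(2)[OF G conn c W])
qed

end
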